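(* Let $\Omega=(0,1)$, $\beta\in(0,2)$, $\lambda\ge0$, and let $g$ be a given function on $\mathbb{R}\setminus\Omega$. Assume that $f\in H^{-\beta/2}(\Omega)$ and that there exists a function $\eta:\mathbb{R}\to\mathbb{R}$ with $\eta=g$ in $\mathbb{R}\setminus\Omega$ satisfying $$\int_\Omega\int_{\mathbb{R}}\frac{(\eta(x)-\eta(y))^2}{|x-y|^{1+\beta}}\,dx\,dy<\infty .$$ Then the problem $$-(\Delta+\lambda)^{\beta/2}p(x)=f(x),\ x\in\Omega,\qquad p(x)=g(x),\ x\in\mathbb{R}\setminus\Omega,$$ has a unique weak solution.
   Context: Functions are real-valued and measurable. The tempered fractional Laplacian is $(\Delta+\lambda)^{\beta/2}p(x)=-c_\beta\,\mathrm{P.V.}\int_{\mathbb{R}}\frac{p(x)-p(y)}{e^{\lambda|x-y|}|x-y|^{1+\beta}}\,dy$, with $c_\beta=\frac{\beta\,\Gamma(\frac{1+\beta}{2})}{2^{1-\beta}\pi^{1/2}\Gamma(1-\beta/2)}$ if $\lambda=0$ or $\beta=1$, and $c_\beta=\frac{\Gamma(1/2)}{2\pi^{1/2}|\Gamma(-\beta)|}$ if $\lambda>0$ and $\beta\ne1$. Its associated bilinear form is $$B(p,v)=\frac{c_\beta}{2}\int_{\mathbb{R}}\int_{\mathbb{R}}\frac{(p(x)-p(y))(v(x)-v(y))}{e^{\lambda|x-y|}|x-y|^{1+\beta}}\,dy\,dx .$$ $H^s$ is the usual Slobodeckii Sobolev space; $\widetilde H_0^{s}(\Omega)$ is the closure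 in $H^s(\mathbb{R})$ of the infinitely differentiable functions on $\mathbb{R}$ with compact support contained in $\Omega$; $H^{-s}(\Omega)$ is the dual of $H_0^s(\Omega)$, the closure of $C_0^\infty(\Omega)$ in $H^s(\Omega)$; $\langle f,v\rangle$ is the duality pairing, formally $\int_\Omega fv\,dx$. Weak solution: a function $p$ on $\mathbb{R}$ is a weak solution if $p=u+\eta$, where $\eta:\mathbb{R}\to\mathbb{R}$ satisfies $\eta=g$ in $\mathbb{R}\setminus\Omega$ and $\int_\Omega\int_{\mathbb{R}}\frac{(\eta(x)-\eta(y))^2}{|x-y|^{1+\beta}}dx\,dy<\infty$, and $u\in\widetilde H_0^{\beta/2}(\Omega)$ satisfies $$B(u,v)=\langle f,v\rangle-B(\eta,v)\qquad\text{for all } v\in\widetilde H_0^{\beta/2}(\Omega).$$ Functions are identified when equal almost everywhere. *)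

theory Defs
  imports "HOL-Analysis.Analysis"
begin

text \<open>
  Functions on a set \<open>S\<close> are represented by total functions on the reals of which only the values
  on \<open>S\<close> matter. Measurability and integration refer to Lebesgue measure, and ``equal'' means equal
  almost everywhere. Function spaces are sets of representatives.
\<close>

subsection \<open>Test functions\<close>

definition test_functions :: "real set \<Rightarrow> (real \<Rightarrow> real) set" where
  "test_functions \<Omega> = {\<phi>.
     (\<forall>n x. ((deriv ^^ n) \<phi>) field_differentiable at x) \<and>
     compact (closure {x. \<phi> x \<noteq> 0}) \<and> closure {x. \<phi> x \<noteq> 0} \<subseteq> \<Omega>}"

subsection \<open>Slobodeckii spaces of order \<open>0 < s < 1\<close>\<close>

definition slobodeckii_sq :: "real \<Rightarrow> real set \<Rightarrow> (real \<Rightarrow> real) \<Rightarrow> ennreal" where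
  "slobodeckii_sq s S u =
     (\<integral>\<^sup>+x. ennreal ((u x)\<^sup>2) \<partial>lebesgue_on S) +
     (\<integral>\<^sup>+x. \<integral>\<^sup>+y. ennreal ((u x - u y)\<^sup>2 / \<bar>x - y\<bar> powr (1 + 2 * s)) \<partial>lebesgue_on S \<partial>lebesgue_on S)"

definition H_space :: "real \<Rightarrow> real set \<Rightarrow> (real \<Rightarrow> real) set" where
  "H_space s S = {u \<in> borel_measurable (lebesgue_on S). slobodeckii_sq s S u < \<infinity>}"

definition H_norm :: "real \<Rightarrow> real set \<Rightarrow> (real \<Rightarrow> real) \<Rightarrow> real" where
  "H_norm s S u = sqrt (enn2real (slobodeckii_sq s S u))"

text \<open>
  The approximants are required to lie in \<^term>\<open>H_space s S\<close> because \<^const>\<open>H_norm\<close> takes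
  the junk value 0 outside that space.
\<close>

definition H_closure :: "real \<Rightarrow> real set \<Rightarrow> (real \<Rightarrow> real) set \<Rightarrow> (real \<Rightarrow> real) set" where
  "H_closure s S A =
     {u \<in> H_space s S. \<forall>\<epsilon>>0. \<exists>\<phi> \<in> A \<inter> H_space s S. H_norm s S (\<lambda>x. u x - \<phi> x) < \<epsilon>}"

definition H0_space :: "real \<Rightarrow> real set \<Rightarrow> (real \<Rightarrow> real) set" where
  "H0_space s \<Omega> = H_closure s \<Omega> (test_functions \<Omega>)"

definition H0_tilde :: "real \<Rightarrow> real set \<Rightarrow> (real \<Rightarrow> real) set" where
  "H0_tilde s \<Omega> = H_closure s UNIV (test_functions \<Omega>)"

text \<open>
  The dual of \<^term>\<open>H0_space s \<Omega>\<close>. Linearity and boundedness force a functional to agree on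
  functions that are equal almost everywhere in \<open>\<Omega>\<close>, so it acts on equivalence classes of functions
  on \<open>\<Omega>\<close>. An element \<open>v\<close> of \<^term>\<open>H0_tilde s \<Omega>\<close> restricts to an element of \<^term>\<open>H0_space s \<Omega>\<close>;
  by the representation of functions on \<open>\<Omega>\<close> this restriction is \<open>v\<close> itself, and the duality pairing of
  \<open>f\<close> and \<open>v\<close> is \<open>f v\<close>.
\<close>

definition H_dual :: "real \<Rightarrow> real set \<Rightarrow> ((real \<Rightarrow> real) \<Rightarrow> real) set" where
  "H_dual s \<Omega> = {f.
     (\<forall>v \<in> H0_space s \<Omega>. \<forall>w \<in> H0_space s \<Omega>. \<forall>a b.
        f (\<lambda>x. a * v x + b * w x) = a * f v + b * f w) \<and>
     (\<exists>C. \<forall>v \<in> H0_space s \<Omega>. \<bar>f v\<bar> \<le> C * H_norm s \<Omega> v)}"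

subsection \<open>The tempered bilinear form and weak solutions\<close>

definition tempered_const :: "real \<Rightarrow> real \<Rightarrow> real" where
  "tempered_const \<beta> lam =
     (if lam = 0 \<or> \<beta> = 1
      then \<beta> * Gamma ((1 + \<beta>) / 2) / (2 powr (1 - \<beta>) * pi powr (1/2) * Gamma (1 - \<beta> / 2))
      else Gamma (1/2) / (2 * pi powr (1/2) * \<bar>Gamma (- \<beta>)\<bar>))"

definition tempered_form :: "real \<Rightarrow> real \<Rightarrow> (real \<Rightarrow> real) \<Rightarrow> (real \<Rightarrow> real) \<Rightarrow> real" where
  "tempered_form \<beta> lam p v = tempered_const \<beta> lam / 2 *
     (LINT x|lebesgue. LINT y|lebesgue.
        (p x - p y) * (v x - v y) / (exp (lam * \<bar>x - y\<bar>) * \<bar>x - y\<bar> powr (1 + \<beta>)))"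

definition admissible_extension ::
    "real \<Rightarrow> real set \<Rightarrow> (real \<Rightarrow> real) \<Rightarrow> (real \<Rightarrow> real) \<Rightarrow> bool" where
  "admissible_extension \<beta> \<Omega> g \<eta> \<longleftrightarrow>
     \<eta> \<in> borel_measurable lebesgue \<and>
     (AE x in lebesgue. x \<notin> \<Omega> \<longrightarrow> \<eta> x = g x) \<and>
     (\<integral>\<^sup>+y. \<integral>\<^sup>+x. ennreal ((\<eta> x - \<eta> y)\<^sup>2 / \<bar>x - y\<bar> powr (1 + \<beta>)) \<partial>lebesgue \<partial>lebesgue_on \<Omega>) < \<infinity>"

text \<open>
  Weak solutions of \<open>-(\<Delta> + lam)\<^bsup>\<beta>/2\<^esup> p = f\<close> in \<open>\<Omega>\<close> with \<open>p = g\<close> in the complement of \<open>\<Omega>\<close>.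
\<close>

definition weak_solution ::
    "real \<Rightarrow> real \<Rightarrow> real set \<Rightarrow> ((real \<Rightarrow> real) \<Rightarrow> real) \<Rightarrow> (real \<Rightarrow> real) \<Rightarrow> (real \<Rightarrow> real) \<Rightarrow> bool" where
  "weak_solution \<beta> lam \<Omega> f g p \<longleftrightarrow>
     p \<in> borel_measurable lebesgue \<and>
     (\<exists>u \<eta>. (AE x in lebesgue. p x = u x + \<eta> x) \<and>
       admissible_extension \<beta> \<Omega> g \<eta> \<and>
       u \<in> H0_tilde (\<beta> / 2) \<Omega> \<and>
       (\<forall>v \<in> H0_tilde (\<beta> / 2) \<Omega>.
          tempered_form \<beta> lam u v = f v - tempered_form \<beta> lam \<eta> v))"

end

theory Submission
  imports Defs
begin

text \<open>
  Write $E(p)$ for the tempered energy $\int\int (p(x)-p(y))^2 e^{-\lambda|x-y|}|x-y|^{-1-\beta}$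
  taken over the pairs $(x,y)$ with at least one entry in \<open>\<Omega>\<close>. Discarding the remaining pairs costs
  nothing when the form is tested with functions that vanish outside \<open>\<Omega>\<close>, and it is what makes an
  admissible extension \<open>\<eta>\<close> have finite energy. Let \<open>V\<close> be the space of functions of finite energy that
  vanish almost everywhere outside \<open>\<Omega>\<close>.

  On \<open>V\<close> the energy controls the full Slobodeckii norm (\<open>coercive\<close>). A function of \<open>V\<close> vanishes on
  the interval from 1 to 2, and the pairs with one entry there and the other in \<open>\<Omega>\<close> already bound its
  $L^2$ norm (\<open>Poincare\<close>); the long-range part of the untempered seminorm is then bounded by the
  $L^2$ norm, and on the short-range part the tempering factor is bounded below. Completeness of
  \<open>V\<close> follows from Fatou's lemma (\<open>energy_space_complete\<close>), and the functional
  $v \mapsto \langle f,v\rangle - B(\eta,v)$ is bounded, so a Riesz representation argument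
  (\<open>Riesz_minimisation\<close>) yields \<open>u \<in> V\<close> solving the equation against all of \<open>V\<close>.

  For uniqueness, let \<open>w\<close> be the difference of two weak solutions, possibly built from different
  extensions. Both extensions agree with \<open>g\<close> outside \<open>\<Omega>\<close>, so \<open>w \<in> V\<close>, and the form vanishes at \<open>w\<close> and
  every test function. Testing with \<open>w\<close> itself gives $E(w) = 0$, hence \<open>w = 0\<close>. 

  Both halves use that \<open>V\<close> is exactly the closure of the test functions (\<open>energy_space_eq_H0_tilde\<close>).
  The hard inclusion is the density of test functions (\<open>H0_tilde_unit_interval\<close>): contract \<open>w\<close> slightly
  towards the midpoint of the interval to make room and mollify. By Jensen's inequality and scaling
  the resulting functions \<open>T n\<close> have Slobodeckii norms bounded by that of \<open>w\<close> up to factors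
  tending to 1. They converge to \<open>w\<close> almost everywhere, because the seminorm itself measures how
  little \<open>w\<close> oscillates at small distances. Convergence almost everywhere without an excess of norm
  in the limit implies convergence in norm (\<open>sq_int_Radon_Riesz\<close>).
\<close>

section \<open>Square integrals: parallelogram law, Fatou, Radon-Riesz\<close>

definition sq_int :: "'a measure \<Rightarrow> ('a \<Rightarrow> real) \<Rightarrow> ennreal" where
  "sq_int M a = (\<integral>\<^sup>+z. ennreal ((a z)\<^sup>2) \<partial>M)"

lemma sq_int_scale:
  assumes [measurable]: "a \<in> borel_measurable M"
  shows "sq_int M (\<lambda>z. c * a z) = ennreal (c\<^sup>2) * sq_int M a"
  by (simp add: sq_int_def power_mult_distrib ennreal_mult nn_integral_cmult)

lemma sq_int_parallelogram:
  assumes [measurable]: "a \<in> borel_measurable M" "b \<in> borel_measurable M"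
  shows "sq_int M (\<lambda>z. a z - b z) + sq_int M (\<lambda>z. a z + b z) = 2 * sq_int M a + 2 * sq_int M b"
proof -
  have "sq_int M (\<lambda>z. a z - b z) + sq_int M (\<lambda>z. a z + b z)
      = (\<integral>\<^sup>+z. ennreal ((a z - b z)\<^sup>2) + ennreal ((a z + b z)\<^sup>2) \<partial>M)"
    by (simp add: sq_int_def nn_integral_add)
  also have "\<dots> = (\<integral>\<^sup>+z. ennreal 2 * ennreal ((a z)\<^sup>2) + ennreal 2 * ennreal ((b z)\<^sup>2) \<partial>M)"
  proof (intro nn_integral_cong)
    fix z
    have "(a z - b z)\<^sup>2 + (a z + b z)\<^sup>2 = 2 * (a z)\<^sup>2 + 2 * (b z)\<^sup>2"
      by (simp add: power2_sum power2_diff)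
    then show "ennreal ((a z - b z)\<^sup>2) + ennreal ((a z + b z)\<^sup>2)
        = ennreal 2 * ennreal ((a z)\<^sup>2) + ennreal 2 * ennreal ((b z)\<^sup>2)"
      by (simp flip: ennreal_plus ennreal_mult del: ennreal_numeral)
  qed
  also have "\<dots> = 2 * sq_int M a + 2 * sq_int M b"
    by (simp add: sq_int_def nn_integral_add nn_integral_cmult)
  finally show ?thesis .
qed

lemma sq_int_add_le:
  assumes "a \<in> borel_measurable M" "b \<in> borel_measurable M"
  shows "sq_int M (\<lambda>z. a z + b z) \<le> 2 * sq_int M a + 2 * sq_int M b"
  unfolding sq_int_parallelogram[OF assms, symmetric] by simp

lemma sq_int_lin_finite:
  assumes [measurable]: "a \<in> borel_measurable M" "b \<in> borel_measurable M"
    and "sq_int M a < \<infinity>" "sq_int M b < \<infinity>"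
  shows "sq_int M (\<lambda>z. c * a z + d * b z) < \<infinity>"
proof -
  have "sq_int M (\<lambda>z. c * a z + d * b z)
      \<le> 2 * (ennreal (c\<^sup>2) * sq_int M a) + 2 * (ennreal (d\<^sup>2) * sq_int M b)"
    using sq_int_add_le[of "\<lambda>z. c * a z" M "\<lambda>z. d * b z"] by (simp add: sq_int_scale)
  also have "\<dots> < \<infinity>"
    using assms by (simp add: ennreal_mult_less_top ennreal_add_eq_top)
  finally show ?thesis .
qed

lemma integrable_mult_sq_int:
  assumes [measurable]: "a \<in> borel_measurable M" "b \<in> borel_measurable M"
    and "sq_int M a < \<infinity>" "sq_int M b < \<infinity>"
  shows "integrable M (\<lambda>z. a z * b z)"
proof (rule Bochner_Integration.integrable_bound)
  show "integrable M (\<lambda>z. (a z)\<^sup>2 + (b z)\<^sup>2)"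
    using assms by (intro Bochner_Integration.integrable_add)
      (auto simp: integrable_iff_bounded sq_int_def)
  have "\<bar>x * y\<bar> \<le> x\<^sup>2 + y\<^sup>2" for x y :: real
    using sum_squares_bound[of x y] sum_squares_bound[of "-x" y] zero_le_power2[of x] zero_le_power2[of y] by (simp add: abs_le_iff)
  then show "AE z in M. norm (a z * b z) \<le> norm ((a z)\<^sup>2 + (b z)\<^sup>2)"
    by auto
qed simp

lemma sq_int_eq_integral:
  assumes [measurable]: "a \<in> borel_measurable M" and "sq_int M a < \<infinity>"
  shows "sq_int M a = ennreal (LINT z|M. a z * a z)"
  using integrable_mult_sq_int[OF assms(1,1,2,2)]
  by (simp add: sq_int_def power2_eq_square nn_integral_eq_integral)

lemma sq_int_Fatou:
  assumes [measurable]: "\<And>n. a n \<in> borel_measurable M" 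
    and lim: "AE z in M. (\<lambda>n. a n z) \<longlonglongrightarrow> b z"
  shows "sq_int M b \<le> liminf (\<lambda>n. sq_int M (a n))"
proof -
  have "sq_int M b = (\<integral>\<^sup>+z. liminf (\<lambda>n. ennreal ((a n z)\<^sup>2)) \<partial>M)"
    unfolding sq_int_def
    by (rule nn_integral_cong_AE)
      (use lim in \<open>eventually_elim, auto intro!: lim_imp_Liminf[symmetric] tendsto_intros\<close>)
  also have "\<dots> \<le> liminf (\<lambda>n. sq_int M (a n))"
    unfolding sq_int_def by (rule nn_integral_liminf) simp
  finally show ?thesis .
qed

lemma sq_int_lim_le:
  assumes "\<And>n. a n \<in> borel_measurable M" "AE z in M. (\<lambda>n. a n z) \<longlonglongrightarrow> b z"
    and "\<forall>\<^sub>F n in sequentially. sq_int M (a n) \<le> C"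
  shows "sq_int M b \<le> C"
  using sq_int_Fatou[OF assms(1,2)] Liminf_le[OF trivial_limit_sequentially assms(3)] by (rule order_trans)

text \<open>
  By the parallelogram law, smallness of $\|a_n - b\|^2$ amounts to $\|a_n + b\|^2$ being nearly
  $4\|b\|^2$. Fatou's lemma supplies this lower bound, so no weak convergence has to be discussed: convergence
  almost everywhere takes its place.
\<close>

lemma sq_int_Radon_Riesz:
  assumes [measurable]: "\<And>n. a n \<in> borel_measurable M" "b \<in> borel_measurable M"
    and lim: "AE z in M. (\<lambda>n. a n z) \<longlonglongrightarrow> b z"
    and le: "\<And>n. sq_int M (a n) \<le> ennreal (t n) * sq_int M b"
    and t0: "\<And>n. 0 \<le> t n" and t: "t \<longlonglongrightarrow> 1" and fin: "sq_int M b < \<infinity>"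
  shows "(\<lambda>n. sq_int M (\<lambda>z. a n z - b z)) \<longlonglongrightarrow> 0"
proof (rule order_tendstoI)
  fix r :: ennreal assume "0 < r"
  then obtain d where d: "0 < d" "d < r" using dense by blast
  then obtain \<delta> where \<delta>: "0 < ennreal \<delta>" "ennreal \<delta> < r"
    by (cases d) (auto simp: top_unique)
  then have \<delta>0: "0 < \<delta>" by simp
  define S where "S = enn2real (sq_int M b)"
  have S: "sq_int M b = ennreal S" and S0: "0 \<le> S"
    using fin by (auto simp: S_def)
  have sum: "sq_int M (\<lambda>z. a n z - b z) + sq_int M (\<lambda>z. a n z + b z) \<le> ennreal (2 * (t n + 1) * S)" for n
  proof -
    have "2 * sq_int M (a n) + 2 * sq_int M b \<le> 2 * (ennreal (t n) * ennreal S) + 2 * ennreal S"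
      using le[of n] S by (intro add_mono mult_left_mono) auto
    also have "\<dots> = ennreal 2 * ennreal (t n) * ennreal S + ennreal 2 * ennreal S"
      by (simp add: mult.assoc)
    also have "\<dots> = ennreal (2 * (t n + 1) * S)"
      using t0[of n] S0 by (simp add: algebra_simps flip: ennreal_plus ennreal_mult del: ennreal_numeral)
    finally show ?thesis
      by (simp add: sq_int_parallelogram)
  qed
  have "sq_int M (\<lambda>z. 2 * b z) \<le> liminf (\<lambda>n. sq_int M (\<lambda>z. a n z + b z))"
  proof (rule sq_int_Fatou)
    show "AE z in M. (\<lambda>n. a n z + b z) \<longlonglongrightarrow> 2 * b z"
      using lim by eventually_elim (subst mult_2, rule tendsto_add[OF _ tendsto_const])
  qed simp
  then have lo: "ennreal (4 * S) \<le> liminf (\<lambda>n. sq_int M (\<lambda>z. a n z + b z))"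
    using S0 by (simp add: sq_int_scale S ennreal_mult)
  have "(\<lambda>n. 2 * (t n + 1) * S) \<longlonglongrightarrow> 2 * (1 + 1) * S"
    by (intro tendsto_intros t)
  then have "\<forall>\<^sub>F n in sequentially. 2 * (t n + 1) * S < 4 * S + \<delta> / 2"
    by (rule order_tendstoD(2)) (use \<delta>0 in simp)
  moreover have "\<forall>\<^sub>F n in sequentially. ennreal (4 * S - \<delta> / 2) \<le> sq_int M (\<lambda>z. a n z + b z)"
  proof (cases "S = 0")
    case False
    then have "ennreal (4 * S - \<delta> / 2) < ennreal (4 * S)"
      using S0 \<delta>0 by (simp add: ennreal_lessI)
    then show ?thesis
      by (rule eventually_mono[OF less_LiminfD[OF less_le_trans[OF _ lo]]]) auto
  qed (use \<delta>0 in \<open>simp add: ennreal_neg\<close>)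
  ultimately show "\<forall>\<^sub>F n in sequentially. sq_int M (\<lambda>z. a n z - b z) < r"
  proof eventually_elim
    case (elim n)
    obtain x y where xy: "sq_int M (\<lambda>z. a n z - b z) = ennreal x" "sq_int M (\<lambda>z. a n z + b z) = ennreal y" "0 \<le> x" "0 \<le> y"
      using sum[of n] by (cases "sq_int M (\<lambda>z. a n z - b z)"; cases "sq_int M (\<lambda>z. a n z + b z)") (auto simp: top_unique)
    have "x + y \<le> 2 * (t n + 1) * S"
      using sum[of n] xy S0 t0[of n] by (simp flip: ennreal_plus)
    moreover have "4 * S - \<delta> / 2 \<le> y"
      using elim(2) xy by (simp add: ennreal_le_iff)
    ultimately have "x < \<delta>" using elim(1) by linarith
    then have "ennreal x < ennreal \<delta>"
      using xy by (simp add: ennreal_lessI \<delta>0)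
    then show ?case using xy \<delta> by simp
  qed
qed simp

text \<open>
  The rate 1/16 leaves room for the weights \<open>4^n\<close>: integrability of $\sum_n 4^n d_n^2$ forces
  $|d_n| \le \sqrt{B}\,2^{-n}$ pointwise, almost everywhere.
\<close>

lemma sq_int_geometric_AE_summable:
  assumes [measurable]: "\<And>n. d n \<in> borel_measurable M"
    and le: "\<And>n. sq_int M (d n) \<le> ennreal (K * (1/16)^n)"
  shows "AE z in M. summable (\<lambda>n. d n z)"
proof -
  have "(\<integral>\<^sup>+z. (\<Sum>n. ennreal (4^n * (d n z)\<^sup>2)) \<partial>M) = (\<Sum>n. ennreal (4^n) * sq_int M (d n))"
    by (simp add: nn_integral_suminf nn_integral_cmult sq_int_def ennreal_mult)
  also have "\<dots> \<le> (\<Sum>n. ennreal (\<bar>K\<bar> * (1/4)^n))"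
  proof (intro suminf_le summableI)
    fix n
    have "ennreal (4^n) * sq_int M (d n) \<le> ennreal (4^n) * ennreal (\<bar>K\<bar> * (1/16)^n)"
      by (intro mult_left_mono order_trans[OF le] ennreal_leI mult_right_mono) auto
    also have "\<dots> = ennreal (\<bar>K\<bar> * (1/4)^n)"
    proof -
      have "(4::real)^n * (\<bar>K\<bar> * (1/16)^n) = \<bar>K\<bar> * (4 * (1/16))^n"
        unfolding power_mult_distrib by (rule mult.left_commute)
      then show ?thesis by (simp flip: ennreal_mult)
    qed
    finally show "ennreal (4^n) * sq_int M (d n) \<le> ennreal (\<bar>K\<bar> * (1/4)^n)" .
  qed
  also have "\<dots> < \<infinity>"
    by (subst suminf_ennreal2) (auto intro!: summable_mult)
  finally have "AE z in M. (\<Sum>n. ennreal (4^n * (d n z)\<^sup>2)) \<noteq> \<infinity>"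
    by (intro nn_integral_PInf_AE) auto
  then show ?thesis
  proof eventually_elim
    case (elim z)
    define B where "B = enn2real (\<Sum>n. ennreal (4^n * (d n z)\<^sup>2))"
    have B: "(\<Sum>n. ennreal (4^n * (d n z)\<^sup>2)) = ennreal B"
      using elim by (simp add: B_def less_top)
    have bound: "norm (d n z) \<le> sqrt B * (1/2)^n" for n
    proof -
      have four: "((2::real)^n)\<^sup>2 = 4^n"
        by (metis mult_2 numeral_Bit0 power2_eq_square power_mult_distrib)
      have "(\<Sum>i\<in>{n}. ennreal (4^i * (d i z)\<^sup>2)) \<le> (\<Sum>i. ennreal (4^i * (d i z)\<^sup>2))"
        by (rule sum_le_suminf) auto
      then have "ennreal (4^n * (d n z)\<^sup>2) \<le> ennreal B"
        unfolding B by simp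
      then have "4^n * (d n z)\<^sup>2 \<le> B"
        by (subst (asm) ennreal_le_iff) (auto simp: B_def)
      then have "(2^n * \<bar>d n z\<bar>)\<^sup>2 \<le> B"
        by (simp add: power_mult_distrib four)
      then have "2^n * \<bar>d n z\<bar> \<le> sqrt B"
        by (rule real_le_rsqrt)
      then show ?thesis by (simp add: field_simps power_divide)
    qed
    show "summable (\<lambda>n. d n z)"
      by (rule summable_comparison_test'[OF _ bound]) (auto intro!: summable_mult)
  qed
qed

lemma sq_int_fast_Cauchy_AE_convergent:
  assumes [measurable]: "\<And>n. u n \<in> borel_measurable M"
    and "\<And>n. sq_int M (\<lambda>z. u (Suc n) z - u n z) \<le> ennreal (K * (1/16)^n)"
  shows "AE z in M. convergent (\<lambda>n. u n z)"
proof -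
  have "AE z in M. summable (\<lambda>n. u (Suc n) z - u n z)"
    using assms(2) by (intro sq_int_geometric_AE_summable) auto
  then show ?thesis
  proof eventually_elim
    case (elim z)
    then have "convergent (\<lambda>n. u n z - u 0 z)"
      by (simp only: summable_iff_convergent sum_lessThan_telescope[of "\<lambda>n. u n z"])
    then show ?case
      by (simp add: convergent_diff_const_right_iff)
  qed
qed

section \<open>Riesz representation by minimisation\<close>

lemma discriminant_nonpos:
  fixes a b c :: real
  assumes quad: "\<And>t. 0 \<le> a + 2 * t * b + t\<^sup>2 * c" and c: "0 \<le> c"
  shows "b\<^sup>2 \<le> a * c"
proof (cases "c = 0")
  case True
  have "b = 0"
  proof (rule ccontr)
    assume ne: "b \<noteq> 0"
    show False
      \<comment> \<open>With \<open>c = 0\<close> this choice of \<open>t\<close> makes the quadratic expression equal to \<open>-1\<close>.\<close>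
      using quad[of "- (a + 1) / (2 * b)"] ne True by (simp add: field_simps)
  qed
  then show ?thesis using True by simp
next
  case False
  then have pos: "0 < c" using c by simp
  have "0 \<le> a - b\<^sup>2 / c"
    using quad[of "- b / c"] False by (simp add: power2_eq_square field_simps)
  then show ?thesis using pos by (simp add: field_simps)
qed

text \<open>
  The minimiser of $J(v) = B(v,v) - 2L(v)$ over \<open>V\<close> represents \<open>L\<close>. A minimising sequence is Cauchy
  because \<open>J\<close> at the midpoint of two of its members cannot fall below the infimum. Choosing the sequence
  to approach the infimum at the rate \<open>(1/16)^n\<close> means that completeness is required only
  for such fast sequences. Elements of \<open>V\<close> are functions rather than classes, and \<open>B\<close> may be degenerate,
  so the limit is only required in the seminorm of \<open>B\<close>.
\<close>

lemma Riesz_minimisation: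
  fixes V :: "('a \<Rightarrow> real) set" and B :: "('a \<Rightarrow> real) \<Rightarrow> ('a \<Rightarrow> real) \<Rightarrow> real" and L :: "('a \<Rightarrow> real) \<Rightarrow> real"
  assumes zero: "(\<lambda>_. 0) \<in> V"
    and lin: "\<And>u v a b. u \<in> V \<Longrightarrow> v \<in> V \<Longrightarrow> (\<lambda>x. a * u x + b * v x) \<in> V"
    and B_lin: "\<And>u v w a b. u \<in> V \<Longrightarrow> v \<in> V \<Longrightarrow> w \<in> V \<Longrightarrow>
                  B (\<lambda>x. a * u x + b * v x) w = a * B u w + b * B v w"
    and B_sym: "\<And>u v. u \<in> V \<Longrightarrow> v \<in> V \<Longrightarrow> B u v = B v u"
    and B_nonneg: "\<And>v. v \<in> V \<Longrightarrow> 0 \<le> B v v"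
    and L_lin: "\<And>u v a b. u \<in> V \<Longrightarrow> v \<in> V \<Longrightarrow> L (\<lambda>x. a * u x + b * v x) = a * L u + b * L v"
    and L_bound: "\<And>v. v \<in> V \<Longrightarrow> \<bar>L v\<bar> \<le> C * sqrt (B v v)"
    and complete: "\<And>v. (\<And>n. v n \<in> V) \<Longrightarrow>
        (\<And>n m. n \<le> m \<Longrightarrow> B (\<lambda>x. v m x - v n x) (\<lambda>x. v m x - v n x) \<le> (1/16)^n) \<Longrightarrow>
        \<exists>u\<in>V. (\<lambda>n. B (\<lambda>x. v n x - u x) (\<lambda>x. v n x - u x)) \<longlonglongrightarrow> 0"
  shows "\<exists>u\<in>V. \<forall>v\<in>V. B u v = L v"
proof -
  have B_lin2: "B w (\<lambda>x. a * u x + b * v x) = a * B w u + b * B w v"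
    if "u \<in> V" "v \<in> V" "w \<in> V" for u v w a b
    using that by (simp add: B_sym[of w] lin B_lin)
  have diff: "(\<lambda>x. u x - v x) \<in> V" if "u \<in> V" "v \<in> V" for u v
    using lin[OF that, of 1 "-1"] by simp
  have B_quad: "B (\<lambda>x. a * u x + b * v x) (\<lambda>x. a * u x + b * v x) = a\<^sup>2 * B u u + 2 * a * b * B u v + b\<^sup>2 * B v v"
    if "u \<in> V" "v \<in> V" for u v a b
    using that by (simp add: lin B_lin B_lin2 B_sym[of v u] power2_eq_square algebra_simps)
  define J where "J v = B v v - 2 * L v" for v
  have J_lower: "- C\<^sup>2 \<le> J v" if "v \<in> V" for v
  proof -
    have "L v \<le> C * sqrt (B v v)" using L_bound[OF that] by simp
    moreover have "0 \<le> (sqrt (B v v) - C)\<^sup>2" by simp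
    moreover have "(sqrt (B v v))\<^sup>2 = B v v" using B_nonneg[OF that] by simp
    ultimately show ?thesis
      unfolding J_def power2_diff by (simp add: mult.commute[of C])
  qed
  define m where "m = Inf (J ` V)"
  have bdd: "bdd_below (J ` V)" using J_lower by (intro bdd_belowI2)
  have m_le: "m \<le> J v" if "v \<in> V" for v
    unfolding m_def using bdd that by (auto intro: cInf_lower)
  have "\<exists>v\<in>V. J v < m + (1/16)^n / 4" for n :: nat
  proof -
    have "Inf (J ` V) < m + (1/16)^n / 4" by (simp add: m_def)
    then show ?thesis using zero by (subst (asm) cInf_less_iff[OF _ bdd]) auto
  qed
  then obtain v where v: "\<And>n. v n \<in> V" and Jv: "\<And>n. J (v n) < m + (1/16)^n / 4"
    by metis
  have "\<exists>u\<in>V. (\<lambda>n. B (\<lambda>x. v n x - u x) (\<lambda>x. v n x - u x)) \<longlonglongrightarrow> 0"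
  proof (rule complete[OF v])
    fix n k :: nat assume nk: "n \<le> k"
    have "J (\<lambda>x. (1/2) * v k x + (1/2) * v n x)
        = J (v k) / 2 + J (v n) / 2 - B (\<lambda>x. v k x - v n x) (\<lambda>x. v k x - v n x) / 4"
      using B_quad[OF v v, of "1/2" k "1/2" n] B_quad[OF v v, of 1 k "-1" n] L_lin[OF v v, of "1/2" k "1/2" n]
      by (simp add: J_def power2_eq_square field_simps)
    moreover have "m \<le> J (\<lambda>x. (1/2) * v k x + (1/2) * v n x)"
      by (rule m_le[OF lin[OF v v]])
    moreover have "(1/16::real)^k \<le> (1/16)^n"
      using nk by (rule power_decreasing) auto
    ultimately show "B (\<lambda>x. v k x - v n x) (\<lambda>x. v k x - v n x) \<le> (1/16)^n"
      using Jv[of n] Jv[of k] by linarith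
  qed
  then obtain u where u: "u \<in> V" and lim: "(\<lambda>n. B (\<lambda>x. v n x - u x) (\<lambda>x. v n x - u x)) \<longlonglongrightarrow> 0"
    by blast
  have CS: "(B p q)\<^sup>2 \<le> B p p * B q q" if "p \<in> V" "q \<in> V" for p q
  proof -
    have quad: "0 \<le> B p p + 2 * t * B p q + t\<^sup>2 * B q q" for t
      using B_nonneg[OF lin[OF that, of 1 t]] B_quad[OF that, of 1 t] by simp
    then show ?thesis by (rule discriminant_nonpos) (rule B_nonneg[OF that(2)])
  qed
  have "B u w = L w" if w: "w \<in> V" for w
  proof -
    have "(\<lambda>n. B (v n) w - B u w) \<longlonglongrightarrow> 0"
    proof (rule Lim_null_comparison[where g="\<lambda>n. sqrt (B (\<lambda>x. v n x - u x) (\<lambda>x. v n x - u x) * B w w)"])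
      show "\<forall>\<^sub>F n in sequentially. norm (B (v n) w - B u w) \<le> sqrt (B (\<lambda>x. v n x - u x) (\<lambda>x. v n x - u x) * B w w)"
      proof (intro always_eventually allI)
        fix n
        have "B (\<lambda>x. v n x - u x) w = B (v n) w - B u w"
          using B_lin[OF v u w, of 1 n "-1"] by simp
        then show "norm (B (v n) w - B u w) \<le> sqrt (B (\<lambda>x. v n x - u x) (\<lambda>x. v n x - u x) * B w w)"
          using CS[OF diff[OF v u] w, of n] by (auto intro!: real_le_rsqrt)
      qed
      show "(\<lambda>n. sqrt (B (\<lambda>x. v n x - u x) (\<lambda>x. v n x - u x) * B w w)) \<longlonglongrightarrow> 0"
        using tendsto_real_sqrt[OF tendsto_mult_left_zero[OF lim, of "B w w"]] by simp
    qed
    then have Bv: "(\<lambda>n. B (v n) w) \<longlonglongrightarrow> B u w"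
      by (simp add: LIM_zero_iff)
    have key: "0 \<le> 2 * t * (B u w - L w) + t\<^sup>2 * B w w" for t
    proof (rule LIMSEQ_le)
      show "(\<lambda>n. - ((1/16)^n / 4) :: real) \<longlonglongrightarrow> 0"
        by (auto intro!: tendsto_eq_intros LIMSEQ_power_zero)
      show "(\<lambda>n. 2 * t * (B (v n) w - L w) + t\<^sup>2 * B w w) \<longlonglongrightarrow> 2 * t * (B u w - L w) + t\<^sup>2 * B w w"
        by (intro tendsto_intros Bv)
      show "\<exists>N. \<forall>n\<ge>N. - ((1/16)^n / 4) \<le> 2 * t * (B (v n) w - L w) + t\<^sup>2 * B w w"
      proof (intro exI allI impI)
        fix n
        \<comment> \<open>Perturbing a near-minimiser cannot lower \<open>J\<close> by more than its distance to the infimum.\<close>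
        have "m \<le> J (\<lambda>x. 1 * v n x + t * w x)" by (rule m_le[OF lin[OF v w]])
        also have "\<dots> = J (v n) + 2 * t * (B (v n) w - L w) + t\<^sup>2 * B w w"
          unfolding J_def B_quad[OF v w] L_lin[OF v w] by (simp add: algebra_simps)
        finally show "- ((1/16)^n / 4) \<le> 2 * t * (B (v n) w - L w) + t\<^sup>2 * B w w"
          using Jv[of n] by linarith
      qed
    qed
    show ?thesis
    proof (rule ccontr)
      assume ne: "B u w \<noteq> L w"
      define a where "a = B u w - L w"
      define b where "b = B w w + 1"
      have ab: "a \<noteq> 0" "0 < b" using ne B_nonneg[OF w] by (auto simp: a_def b_def)
      \<comment> \<open>\<open>b\<close> is \<open>B w w + 1\<close> instead of \<open>B w w\<close> so that \<open>t = - a / b\<close>, close to the optimal choice, may be used without excluding \<open>B w w = 0\<close>.\<close>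
      have "0 \<le> 2 * (- a / b) * a + (- a / b)\<^sup>2 * (b - 1)"
        using key[of "- a / b"] by (simp add: a_def b_def)
      also have "\<dots> = - (a\<^sup>2 / b) - (a / b)\<^sup>2"
        using ab by (simp add: field_simps power2_eq_square)
      also have "\<dots> < 0"
        using ab by (smt (verit) divide_pos_pos zero_less_power2 zero_le_power2)
      finally show False by simp
    qed
  qed
  then show ?thesis using u by blast
qed

section \<open>Smooth functions and convolution\<close>

definition smooth :: "(real \<Rightarrow> real) \<Rightarrow> bool" where
  "smooth f \<longleftrightarrow> (\<forall>n x. ((deriv ^^ n) f) field_differentiable at x)"

text \<open>
  A set of functions closed under differentiation consists of smooth functions. This turns each
  smoothness proof below into one derivative computation on a suitable set.
\<close>

lemma smooth_coinduct:
  assumes "f \<in> S" and step: "\<And>f. f \<in> S \<Longrightarrow> \<exists>g\<in>S. \<forall>x. (f has_real_derivative g x) (at x)"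
  shows "smooth f"
proof -
  have deriv: "deriv f \<in> S" if f: "f \<in> S" for f
  proof -
    obtain g where g: "g \<in> S" "\<And>x. (f has_real_derivative g x) (at x)"
      using step[OF f] by blast
    then have "deriv f = g" by (auto intro: DERIV_imp_deriv)
    then show ?thesis using g by simp
  qed
  have "(deriv ^^ n) f \<in> S" for n
    by (induction n) (auto simp: \<open>f \<in> S\<close> deriv)
  then show ?thesis
    unfolding smooth_def using step by (meson field_differentiable_def)
qed

lemma smooth_deriv:
  assumes "smooth f"
  shows "(f has_real_derivative deriv f x) (at x)" and "smooth (deriv f)"
proof -
  have D: "((deriv ^^ n) f) field_differentiable at x" for n x
    using assms by (simp add: smooth_def)
  show "(f has_real_derivative deriv f x) (at x)"
    using D[of 0 x] by (simp add: DERIV_deriv_iff_field_differentiable)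
  show "smooth (deriv f)"
    unfolding smooth_def using D[of "Suc n" for n] by (simp add: funpow_swap1)
qed

lemma smooth_continuous_on: "smooth f \<Longrightarrow> continuous_on A f"
  using smooth_deriv(1) by (meson DERIV_isCont continuous_at_imp_continuous_on)

lemma smooth_affine:
  assumes "smooth f"
  shows "smooth (\<lambda>x. k * f (a * x + c))"
proof (rule smooth_coinduct)
  let ?S = "{\<lambda>x. k * f (a * x + c) | k f. smooth f}"
  show "(\<lambda>x. k * f (a * x + c)) \<in> ?S" using assms by blast
  fix h assume "h \<in> ?S"
  then obtain k f where h: "h = (\<lambda>x. k * f (a * x + c))" and f: "smooth f" by blast
  have "(h has_real_derivative (k * a) * deriv f (a * x + c)) (at x)" for x
    unfolding h
    by (rule derivative_eq_intros DERIV_chain2[OF smooth_deriv(1)[OF f]] refl | simp)+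
  moreover have "(\<lambda>x. (k * a) * deriv f (a * x + c)) \<in> ?S"
    using smooth_deriv(2)[OF f] by blast
  ultimately show "\<exists>g\<in>?S. \<forall>x. (h has_real_derivative g x) (at x)"
    by (intro bexI[of _ "\<lambda>x. (k * a) * deriv f (a * x + c)"] allI)
qed

text \<open>
  The products of smooth functions are not closed under differentiation, but their finite sums are.
\<close>

inductive_set sums_of_products :: "(real \<Rightarrow> real) set" where
  prod: "smooth f \<Longrightarrow> smooth g \<Longrightarrow> (\<lambda>x. f x * g x) \<in> sums_of_products"
| sum: "f \<in> sums_of_products \<Longrightarrow> g \<in> sums_of_products \<Longrightarrow> (\<lambda>x. f x + g x) \<in> sums_of_products"

lemma smooth_mult:
  assumes "smooth f" "smooth g"
  shows "smooth (\<lambda>x. f x * g x)"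
proof (rule smooth_coinduct[OF sums_of_products.prod[OF assms]])
  fix h assume "h \<in> sums_of_products"
  then show "\<exists>g\<in>sums_of_products. \<forall>x. (h has_real_derivative g x) (at x)"
  proof induction
    case (prod f g)
    note D = smooth_deriv[OF prod(1)] smooth_deriv[OF prod(2)]
    show ?case
      by (intro bexI[of _ "\<lambda>x. f x * deriv g x + deriv f x * g x"] allI DERIV_mult' D
          sums_of_products.intros prod)
  next
    case (sum f g)
    then obtain f' g' where "f' \<in> sums_of_products" "g' \<in> sums_of_products"
      and "\<And>x. (f has_real_derivative f' x) (at x)" "\<And>x. (g has_real_derivative g' x) (at x)"
      by blast
    then show ?case
      by (intro bexI[of _ "\<lambda>x. f' x + g' x"] allI DERIV_add sums_of_products.sum)
  qed
qed

text \<open>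
  For constant \<open>p = 1\<close> this is the classical function $e^{-1/x}$ that is flat at the origin;
  the polynomial factor makes the family closed under differentiation.
\<close>

definition flat :: "real poly \<Rightarrow> real \<Rightarrow> real" where
  "flat p x = (if 0 < x then poly p (1 / x) * exp (- (1 / x)) else 0)"

lemma poly_exp_tendsto_0: "((\<lambda>y::real. y ^ k * poly p y * exp (- y)) \<longlongrightarrow> 0) at_top"
proof (induction p arbitrary: k)
  case (pCons a p)
  have "((\<lambda>y::real. a * (y ^ k / exp y) + y ^ Suc k * poly p y * exp (- y)) \<longlongrightarrow> a * 0 + 0) at_top"
    by (intro tendsto_intros tendsto_power_div_exp_0 pCons)
  then show ?case
    by (simp add: algebra_simps exp_minus field_simps)
qed simp

lemma flat_has_derivative:
  "(flat p has_real_derivative flat ([:0, 0, 1:] * (p - pderiv p)) x) (at x)"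
proof -
  consider "0 < x" | "x < 0" | "x = 0" by linarith
  then show ?thesis
  proof cases
    case 1
    have inv: "((\<lambda>x. 1 / x) has_real_derivative - (1 / x * (1 / x))) (at x)"
      using DERIV_inverse[of x UNIV] 1 by (simp add: inverse_eq_divide power2_eq_square)
    have "((\<lambda>x. poly p (1 / x) * exp (- (1 / x))) has_real_derivative
        poly p (1 / x) * (exp (- (1 / x)) * - (- (1 / x * (1 / x)))) +
        poly (pderiv p) (1 / x) * - (1 / x * (1 / x)) * exp (- (1 / x))) (at x)"
      by (intro DERIV_mult' DERIV_chain2[OF poly_DERIV inv] DERIV_chain2[OF DERIV_exp] DERIV_minus inv)
    moreover have "poly p (1 / x) * (exp (- (1 / x)) * - (- (1 / x * (1 / x)))) +
        poly (pderiv p) (1 / x) * - (1 / x * (1 / x)) * exp (- (1 / x))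
        = flat ([:0, 0, 1:] * (p - pderiv p)) x"
      using 1 by (simp add: flat_def left_diff_distrib right_diff_distrib)
    ultimately have "((\<lambda>x. poly p (1 / x) * exp (- (1 / x))) has_real_derivative
        flat ([:0, 0, 1:] * (p - pderiv p)) x) (at x)"
      by simp
    then show ?thesis
      by (rule has_field_derivative_transform_within_open[where S="{0<..}"]) (use 1 in \<open>auto simp: flat_def\<close>)
  next
    case 2
    have "((\<lambda>x. 0) has_real_derivative flat ([:0, 0, 1:] * (p - pderiv p)) x) (at x)"
      using 2 by (simp add: flat_def)
    then show ?thesis
      by (rule has_field_derivative_transform_within_open[where S="{..<0}"]) (use 2 in \<open>auto simp: flat_def\<close>)
  next
    case 3
    have "((\<lambda>h. flat p h / h) \<longlongrightarrow> 0) (at 0)"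
    proof (rule filterlim_split_at)
      show "((\<lambda>h. flat p h / h) \<longlongrightarrow> 0) (at_left 0)"
        by (rule tendsto_eventually) (auto simp: flat_def eventually_at_filter)
      have "((\<lambda>h::real. inverse h ^ 1 * poly p (inverse h) * exp (- inverse h)) \<longlongrightarrow> 0) (at_right 0)"
        by (rule filterlim_compose[OF poly_exp_tendsto_0 filterlim_inverse_at_top_right])
      then show "((\<lambda>h. flat p h / h) \<longlongrightarrow> 0) (at_right 0)"
        by (rule Lim_transform_eventually)
          (auto simp: flat_def eventually_at_filter field_simps)
    qed
    then show ?thesis
      using 3 by (simp add: has_field_derivative_iff flat_def[of _ 0])
  qed
qed

lemma smooth_flat: "smooth (flat p)"
  by (rule smooth_coinduct[of _ "range flat"]) (use flat_has_derivative in blast)+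

text \<open>
  The normalised product $e^{-1/(1+z)} e^{-1/(1-z)}$ on the interval from -1 to 1.
\<close>

lemma exists_smooth_bump:
  "\<exists>b::real \<Rightarrow> real. smooth b \<and> (\<forall>z. 0 \<le> b z) \<and> (\<forall>z. 1 < \<bar>z\<bar> \<longrightarrow> b z = 0) \<and>
     integrable lborel b \<and> integral\<^sup>L lborel b = 1 \<and> (\<exists>M. \<forall>z. b z \<le> M)"
proof -
  define e where "e = flat 1"
  define b0 where "b0 z = e (1 * z + 1) * e ((-1) * z + 1)" for z
  have e: "smooth (\<lambda>z. 1 * e (a * z + c))" for a c
    unfolding e_def by (intro smooth_affine smooth_flat)
  have smooth: "smooth b0"
    unfolding b0_def using smooth_mult[OF e[of 1 1] e[of "-1" 1]] by simp
  have e_nonneg: "0 \<le> e z" and e_le: "e z \<le> 1" for z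
    by (auto simp: e_def flat_def)
  have nonneg: "0 \<le> b0 z" and le: "b0 z \<le> 1" for z
    using e_nonneg e_le by (auto simp: b0_def intro!: mult_le_one)
  have supp: "b0 z = 0" if "1 < \<bar>z\<bar>" for z
    using that by (auto simp: b0_def e_def flat_def)
  have pos: "0 < b0 z" if "\<bar>z\<bar> < 1" for z
    using that by (auto simp: b0_def e_def flat_def)
  have [measurable]: "b0 \<in> borel_measurable borel"
    by (intro borel_measurable_continuous_onI smooth_continuous_on smooth)
  have int: "integrable lborel b0"
  proof (rule Bochner_Integration.integrable_bound)
    show "integrable lborel (indicator {-1..1::real} :: real \<Rightarrow> real)" by simp
    show "AE z in lborel. norm (b0 z) \<le> norm (indicator {-1..1::real} z :: real)"
    proof (intro AE_I2)
      fix z show "norm (b0 z) \<le> norm (indicator {-1..1::real} z :: real)"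
        using nonneg[of z] le[of z] supp[of z] by (cases "1 < \<bar>z\<bar>") (auto simp: indicator_def)
    qed
  qed simp
  define I where "I = integral\<^sup>L lborel b0"
  have "I \<noteq> 0"
  proof
    assume "I = 0"
    then have "AE z in lborel. b0 z = 0"
      using integral_nonneg_eq_0_iff_AE[OF int] nonneg by (simp add: I_def)
    then have "AE z in lborel. z \<notin> {-1<..<1::real}"
      by (rule eventually_mono) (use pos in \<open>force simp: abs_less_iff\<close>)
    then have "emeasure lborel {-1<..<1::real} = 0"
      by (subst (asm) AE_iff_measurable[of "{-1<..<1::real}"]) auto
    then show False by simp
  qed
  moreover have "0 \<le> I"
    unfolding I_def by (rule integral_nonneg_AE) (simp add: nonneg)
  ultimately have I: "0 < I" by simp
  show ?thesis
  proof (intro exI[of _ "\<lambda>z. (1 / I) * b0 (1 * z + 0)"] conjI allI impI exI[of _ "1 / I"])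
    show "smooth (\<lambda>z. (1 / I) * b0 (1 * z + 0))" by (rule smooth_affine[OF smooth])
  qed (use I nonneg le supp int in \<open>auto simp: divide_right_mono I_def[symmetric]\<close>)
qed

text \<open>
  The derivative may be taken under the integral by dominated convergence: the difference quotients of \<open>\<phi>\<close>
  are bounded by the supremum of its derivative, which is finite by compact support.
\<close>

lemma smooth_convolution:
  assumes \<phi>: "smooth \<phi>" and supp: "\<And>z. R < \<bar>z\<bar> \<Longrightarrow> \<phi> z = 0" and w: "integrable lborel w"
  shows "smooth (\<lambda>x. LINT y|lborel. \<phi> (x - y) * w y)"
proof (rule smooth_coinduct)
  let ?F = "\<lambda>\<phi> x. LINT y|lborel. \<phi> (x - y) * w y"
  let ?S = "{?F \<phi> | \<phi>. smooth \<phi> \<and> (\<forall>z. R < \<bar>z\<bar> \<longrightarrow> \<phi> z = 0)}"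
  show "?F \<phi> \<in> ?S" using \<phi> supp by blast
  have [measurable]: "w \<in> borel_measurable borel" using w by auto
  have bounded: "\<exists>M\<ge>0. \<forall>z. \<bar>\<phi> z\<bar> \<le> M" if sm: "smooth \<phi>" and su: "\<And>z. R < \<bar>z\<bar> \<Longrightarrow> \<phi> z = 0" for \<phi>
  proof -
    have "bounded (\<phi> ` {-R..R})"
      by (intro compact_imp_bounded compact_continuous_image smooth_continuous_on sm) simp
    then obtain M where M: "\<And>z. z \<in> {-R..R} \<Longrightarrow> \<bar>\<phi> z\<bar> \<le> M"
      unfolding bounded_iff by (metis imageI real_norm_def)
    have "\<bar>\<phi> z\<bar> \<le> max M 0" for z
      using M[of z] su[of z] by (cases "R < \<bar>z\<bar>") (auto simp: not_less abs_le_iff le_max_iff_disj)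
    then show ?thesis by (intro exI[of _ "max M 0"]) simp
  qed
  fix F assume "F \<in> ?S"
  then obtain \<phi> where F: "F = ?F \<phi>" and sm: "smooth \<phi>" and su: "\<And>z. R < \<bar>z\<bar> \<Longrightarrow> \<phi> z = 0" by blast
  have su': "deriv \<phi> z = 0" if z: "R < \<bar>z\<bar>" for z
  proof -
    have "open {z. R < \<bar>z\<bar>}" by (intro open_Collect_less continuous_intros)
    have "(\<phi> has_real_derivative 0) (at z)"
      by (rule has_field_derivative_transform_within_open[OF DERIV_const \<open>open {z. R < \<bar>z\<bar>}\<close>])
        (use z su in auto)
    then show ?thesis by (rule DERIV_imp_deriv)
  qed
  have [measurable]: "\<phi> \<in> borel_measurable borel" "deriv \<phi> \<in> borel_measurable borel"
    by (intro borel_measurable_continuous_onI smooth_continuous_on smooth_deriv sm)+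
  obtain M0 where M0: "0 \<le> M0" "\<And>z. \<bar>\<phi> z\<bar> \<le> M0" using bounded[OF sm su] by blast
  obtain M where M: "0 \<le> M" "\<And>z. \<bar>deriv \<phi> z\<bar> \<le> M" using bounded[OF smooth_deriv(2)[OF sm] su'] by blast
  have lip: "\<bar>\<phi> a - \<phi> b\<bar> \<le> M * \<bar>a - b\<bar>" for a b
    using field_differentiable_bound[of UNIV \<phi> "deriv \<phi>" M a b] smooth_deriv(1)[OF sm] M(2)
    by auto
  have int: "integrable lborel (\<lambda>y. \<phi> (x - y) * w y)" for x
  proof (rule Bochner_Integration.integrable_bound)
    show "integrable lborel (\<lambda>y. M0 * w y)" using w by simp
    show "AE y in lborel. norm (\<phi> (x - y) * w y) \<le> norm (M0 * w y)"
      using M0 by (auto simp: abs_mult intro!: mult_right_mono)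
  qed measurable
  have "(F has_real_derivative ?F (deriv \<phi>) x) (at x)" for x
    unfolding DERIV_def tendsto_at_iff_sequentially comp_def
  proof (intro allI impI)
    fix X :: "nat \<Rightarrow> real" assume X0: "\<forall>i. X i \<in> UNIV - {0}" and X: "X \<longlonglongrightarrow> 0"
    have "(F (x + X n) - F x) / X n = (LINT y|lborel. (\<phi> (x + X n - y) * w y - \<phi> (x - y) * w y) / X n)" for n
      unfolding F by (simp add: Bochner_Integration.integral_diff[OF int int])
    then have quot: "(F (x + X n) - F x) / X n = (LINT y|lborel. (\<phi> (x + X n - y) - \<phi> (x - y)) / X n * w y)" for n
      by (simp add: left_diff_distrib)
    have "(\<lambda>n. LINT y|lborel. (\<phi> (x + X n - y) - \<phi> (x - y)) / X n * w y) \<longlonglongrightarrow> ?F (deriv \<phi>) x"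
    proof (rule integral_dominated_convergence[where w="\<lambda>y. M * \<bar>w y\<bar>"])
      show "AE y in lborel. (\<lambda>n. (\<phi> (x + X n - y) - \<phi> (x - y)) / X n * w y) \<longlonglongrightarrow> deriv \<phi> (x - y) * w y"
      proof (intro AE_I2 tendsto_mult tendsto_const)
        fix y
        have "((\<lambda>h. (\<phi> ((x - y) + h) - \<phi> (x - y)) / h) \<longlongrightarrow> deriv \<phi> (x - y)) (at 0)"
          using smooth_deriv(1)[OF sm] by (simp add: DERIV_def)
        then have "(\<lambda>n. (\<phi> ((x - y) + X n) - \<phi> (x - y)) / X n) \<longlonglongrightarrow> deriv \<phi> (x - y)"
          using X X0 by (auto simp: tendsto_at_iff_sequentially comp_def)
        then show "(\<lambda>n. (\<phi> (x + X n - y) - \<phi> (x - y)) / X n) \<longlonglongrightarrow> deriv \<phi> (x - y)"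
          by (simp add: algebra_simps)
      qed
      show "AE y in lborel. norm ((\<phi> (x + X n - y) - \<phi> (x - y)) / X n * w y) \<le> M * \<bar>w y\<bar>" for n
      proof (intro AE_I2)
        fix y
        have "\<bar>(\<phi> (x + X n - y) - \<phi> (x - y)) / X n\<bar> \<le> M"
          using lip[of "x + X n - y" "x - y"] X0 by (simp add: abs_divide pos_divide_le_eq)
        then show "norm ((\<phi> (x + X n - y) - \<phi> (x - y)) / X n * w y) \<le> M * \<bar>w y\<bar>"
          unfolding real_norm_def abs_mult by (rule mult_right_mono) simp
      qed
    qed (use w in auto)
    then show "(\<lambda>n. (F (x + X n) - F x) / X n) \<longlonglongrightarrow> ?F (deriv \<phi>) x"
      by (simp only: quot)
  qed
  moreover have "?F (deriv \<phi>) \<in> ?S"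
    using smooth_deriv(2)[OF sm] su' by blast
  ultimately show "\<exists>g\<in>?S. \<forall>x. (F has_real_derivative g x) (at x)"
    by (intro bexI[of _ "?F (deriv \<phi>)"] allI)
qed

section \<open>Density of test functions in the unit interval\<close>

text \<open>
  Integrate $b\,(g - m)^2 \ge 0$, where \<open>m\<close> is the mean of \<open>g\<close>. If \<open>b g\<close> is not integrable, its Bochner
  integral is 0 by convention and the claim is trivial.
\<close>

lemma Jensen_square:
  fixes b g :: "'a \<Rightarrow> real"
  assumes b: "integrable M b" "\<And>z. 0 \<le> b z" "integral\<^sup>L M b = 1"
    and [measurable]: "g \<in> borel_measurable M"
  shows "ennreal ((LINT z|M. b z * g z)\<^sup>2) \<le> (\<integral>\<^sup>+z. ennreal (b z * (g z)\<^sup>2) \<partial>M)"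
proof (cases "(\<integral>\<^sup>+z. ennreal (b z * (g z)\<^sup>2) \<partial>M) = \<infinity> \<or> \<not> integrable M (\<lambda>z. b z * g z)")
  case True
  then show ?thesis by (auto simp: not_integrable_integral_eq)
next
  case False
  have [measurable]: "b \<in> borel_measurable M" using b(1) by simp
  have int1: "integrable M (\<lambda>z. b z * g z)" using False by simp
  have int2: "integrable M (\<lambda>z. b z * (g z)\<^sup>2)"
    using False b(2) by (simp add: integrable_iff_bounded less_top)
  define m where "m = (LINT z|M. b z * g z)"
  have "0 \<le> (LINT z|M. b z * (g z)\<^sup>2 - 2 * m * (b z * g z) + m\<^sup>2 * b z)"
  proof (rule integral_nonneg_AE, intro AE_I2)
    fix z
    have "b z * (g z)\<^sup>2 - 2 * m * (b z * g z) + m\<^sup>2 * b z = b z * (g z - m)\<^sup>2"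
      by (simp add: power2_diff algebra_simps)
    then show "0 \<le> b z * (g z)\<^sup>2 - 2 * m * (b z * g z) + m\<^sup>2 * b z" using b(2) by simp
  qed
  also have "\<dots> = (LINT z|M. b z * (g z)\<^sup>2) - m\<^sup>2"
    using int1 int2 b by (simp add: m_def power2_eq_square)
  finally have "m\<^sup>2 \<le> (LINT z|M. b z * (g z)\<^sup>2)" by simp
  then show ?thesis
    using int2 b(2) by (simp add: nn_integral_eq_integral m_def ennreal_leI)
qed

lemma nn_integral_affine_le:
  fixes t c :: real and f :: "real \<Rightarrow> ennreal"
  assumes "f \<in> borel_measurable borel" "1 \<le> t"
  shows "(\<integral>\<^sup>+x. f (c + t * x) \<partial>lborel) \<le> (\<integral>\<^sup>+x. f x \<partial>lborel)"
proof -
  have "1 * (\<integral>\<^sup>+x. f (c + t * x) \<partial>lborel) \<le> ennreal \<bar>t\<bar> * (\<integral>\<^sup>+x. f (c + t * x) \<partial>lborel)"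
    using assms(2) by (intro mult_right_mono) auto
  then show ?thesis
    using assms by (simp add: nn_integral_real_affine[of f t c])
qed

lemma double_nn_integral_affine:
  fixes t c :: real and F :: "real \<Rightarrow> real \<Rightarrow> ennreal"
  assumes [measurable]: "case_prod F \<in> borel_measurable (borel \<Otimes>\<^sub>M borel)" and t: "0 < t"
  shows "(\<integral>\<^sup>+x. \<integral>\<^sup>+y. F x y \<partial>lborel \<partial>lborel)
       = ennreal (t\<^sup>2) * (\<integral>\<^sup>+x. \<integral>\<^sup>+y. F (c + t * x) (c + t * y) \<partial>lborel \<partial>lborel)"
proof -
  have "(\<integral>\<^sup>+x. \<integral>\<^sup>+y. F x y \<partial>lborel \<partial>lborel)
      = ennreal t * (\<integral>\<^sup>+x. \<integral>\<^sup>+y. F (c + t * x) y \<partial>lborel \<partial>lborel)"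
    using t by (subst nn_integral_real_affine[of _ t c]) auto
  also have "(\<integral>\<^sup>+x. \<integral>\<^sup>+y. F (c + t * x) y \<partial>lborel \<partial>lborel)
      = (\<integral>\<^sup>+x. ennreal t * (\<integral>\<^sup>+y. F (c + t * x) (c + t * y) \<partial>lborel) \<partial>lborel)"
  proof (intro nn_integral_cong)
    fix x
    show "(\<integral>\<^sup>+y. F (c + t * x) y \<partial>lborel) = ennreal t * (\<integral>\<^sup>+y. F (c + t * x) (c + t * y) \<partial>lborel)"
      using t by (subst nn_integral_real_affine[of _ t c]) auto
  qed
  also have "\<dots> = ennreal t * (\<integral>\<^sup>+x. \<integral>\<^sup>+y. F (c + t * x) (c + t * y) \<partial>lborel \<partial>lborel)"
    by (rule nn_integral_cmult) measurable
  finally show ?thesis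
    using t by (simp add: power2_eq_square ennreal_mult mult.assoc)
qed

text \<open>
  With \<open>k\<close> the square root of an interaction kernel, the Gagliardo-type double integral of \<open>u\<close> for that kernel
  is the square integral of \<open>gap k u\<close> over the plane; this makes seminorms instances of \<^const>\<open>sq_int\<close>.
\<close>

definition gap :: "(real \<times> real \<Rightarrow> real) \<Rightarrow> (real \<Rightarrow> real) \<Rightarrow> real \<times> real \<Rightarrow> real" where
  "gap k u = (\<lambda>(x, y). (u x - u y) * k (x, y))"

definition slobodeckii_weight :: "real \<Rightarrow> real \<times> real \<Rightarrow> real" where
  "slobodeckii_weight s = (\<lambda>(x, y). \<bar>x - y\<bar> powr (- (1 / 2 + s)))"

lemma slobodeckii_weight_square:
  "(gap (slobodeckii_weight s) u (x, y))\<^sup>2 = (u x - u y)\<^sup>2 / \<bar>x - y\<bar> powr (1 + 2 * s)"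
proof -
  have "(\<bar>x - y\<bar> powr (- (1 / 2 + s)))\<^sup>2 = 1 / \<bar>x - y\<bar> powr (1 + 2 * s)"
    by (simp add: power2_eq_square flip: powr_add powr_minus_divide)
  then show ?thesis
    by (simp add: gap_def slobodeckii_weight_def power_mult_distrib)
qed

lemma measurable_slobodeckii_weight[measurable]:
  "slobodeckii_weight s \<in> borel_measurable (borel \<Otimes>\<^sub>M borel)"
  unfolding slobodeckii_weight_def by measurable

lemma measurable_gap:
  assumes [measurable]: "u \<in> borel_measurable M" "k \<in> borel_measurable (M \<Otimes>\<^sub>M M)"
  shows "gap k u \<in> borel_measurable (M \<Otimes>\<^sub>M M)"
  unfolding gap_def by measurable

lemma slobodeckii_sq_lborel:
  assumes [measurable]: "u \<in> borel_measurable borel"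
  shows "slobodeckii_sq s UNIV u = sq_int lborel u + sq_int (lborel \<Otimes>\<^sub>M lborel) (gap (slobodeckii_weight s) u)"
proof -
  have [measurable]: "gap (slobodeckii_weight s) u \<in> borel_measurable (borel \<Otimes>\<^sub>M borel)"
    by (rule measurable_gap) auto
  show ?thesis
    unfolding slobodeckii_sq_def sq_int_def
    by (simp add: lebesgue_on_UNIV_eq nn_integral_completion slobodeckii_weight_square flip: lborel.nn_integral_fst)
qed

lemma slobodeckii_sq_cong_AE:
  assumes "AE x in lebesgue. u x = v x"
  shows "slobodeckii_sq s UNIV u = slobodeckii_sq s UNIV v"
proof -
  have "(\<integral>\<^sup>+x. \<integral>\<^sup>+y. ennreal ((u x - u y)\<^sup>2 / \<bar>x - y\<bar> powr (1 + 2 * s)) \<partial>lebesgue \<partial>lebesgue)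
      = (\<integral>\<^sup>+x. \<integral>\<^sup>+y. ennreal ((v x - v y)\<^sup>2 / \<bar>x - y\<bar> powr (1 + 2 * s)) \<partial>lebesgue \<partial>lebesgue)"
  proof (rule nn_integral_cong_AE, use assms in eventually_elim)
    case (elim x)
    show ?case by (rule nn_integral_cong_AE, use assms in eventually_elim) (simp add: elim)
  qed
  moreover have "(\<integral>\<^sup>+x. ennreal ((u x)\<^sup>2) \<partial>lebesgue) = (\<integral>\<^sup>+x. ennreal ((v x)\<^sup>2) \<partial>lebesgue)"
    by (rule nn_integral_cong_AE, use assms in eventually_elim) simp
  ultimately show ?thesis by (simp add: slobodeckii_sq_def lebesgue_on_UNIV_eq)
qed

locale mollifier =
  fixes b :: "real \<Rightarrow> real" and M :: real
  assumes smooth: "smooth b" and nonneg: "\<And>z. 0 \<le> b z" and supp: "\<And>z. 1 < \<bar>z\<bar> \<Longrightarrow> b z = 0"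
    and integrable: "integrable lborel b" and integral_1: "integral\<^sup>L lborel b = 1"
    and le: "\<And>z. b z \<le> M"
begin

lemma M_nonneg: "0 \<le> M" using nonneg[of 0] le[of 0] by simp

lemma measurable_b[measurable]: "b \<in> borel_measurable borel"
  using integrable by auto

text \<open>
  The map $x \mapsto (1+4\epsilon)x - 2\epsilon$ dilates by $1+4\epsilon$ about the midpoint 1/2, so composing
  with it pulls the support of \<open>w\<close> away from the end points, by twice as much as the mollification
  then spreads it out again.
\<close>

definition average :: "real \<Rightarrow> (real \<Rightarrow> real) \<Rightarrow> real \<Rightarrow> real" where
  "average \<epsilon> w x = (LINT z|lborel. b z * w ((1 + 4 * \<epsilon>) * x - 2 * \<epsilon> - \<epsilon> * z))"

lemma measurable_average[measurable]:
  assumes [measurable]: "w \<in> borel_measurable borel"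
  shows "average \<epsilon> w \<in> borel_measurable borel"
  unfolding average_def by measurable

lemma integrable_average:
  assumes w: "integrable lborel w" and \<epsilon>: "0 < \<epsilon>"
  shows "integrable lborel (\<lambda>z. b z * w (X - \<epsilon> * z))"
proof (rule Bochner_Integration.integrable_bound)
  have [measurable]: "w \<in> borel_measurable borel" using w by auto
  show "(\<lambda>z. b z * w (X - \<epsilon> * z)) \<in> borel_measurable lborel" by simp
  have "integrable lborel (\<lambda>z. w (X + (- \<epsilon>) * z))"
    by (rule lborel_integrable_real_affine) (use w \<epsilon> in auto)
  then show "integrable lborel (\<lambda>z. M * w (X - \<epsilon> * z))" by simp
  show "AE z in lborel. norm (b z * w (X - \<epsilon> * z)) \<le> norm (M * w (X - \<epsilon> * z))"
    using nonneg le by (auto simp: abs_mult intro!: mult_right_mono abs_leI order_trans[OF le] )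
qed

text \<open>
  After the substitution $y = X - \epsilon z$ the average is the convolution of \<open>w\<close> with a smooth kernel of
  width \<open>\<epsilon>\<close>, composed with an affine map; smoothness is inherited from the kernel.
\<close>

lemma average_test_function:
  assumes w: "integrable lborel w" and w0: "\<And>x. x \<notin> {0<..<1} \<Longrightarrow> w x = 0" and \<epsilon>: "0 < \<epsilon>"
  shows "average \<epsilon> w \<in> test_functions {0<..<1}"
proof -
  define \<phi> where "\<phi> z = (1 / \<epsilon>) * b ((1 / \<epsilon>) * z + 0)" for z
  have "average \<epsilon> w x = (LINT y|lborel. \<phi> (((1 + 4 * \<epsilon>) * x + (- 2 * \<epsilon>)) - y) * w y)" for x
  proof -
    let ?X = "(1 + 4 * \<epsilon>) * x + (- 2 * \<epsilon>)"
    have "(LINT y|lborel. \<phi> (?X - y) * w y) = \<bar>- \<epsilon>\<bar> *\<^sub>R (LINT z|lborel. \<phi> (?X - (?X + (- \<epsilon>) * z)) * w (?X + (- \<epsilon>) * z))"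
      using \<epsilon> by (intro lborel_integral_real_affine) auto
    also have "\<dots> = \<epsilon> * (LINT z|lborel. (1 / \<epsilon>) * (b z * w (?X - \<epsilon> * z)))"
      using \<epsilon> by (simp add: \<phi>_def)
    also have "\<dots> = average \<epsilon> w x"
      using \<epsilon> by (simp only: integral_mult_right_zero) (simp add: average_def)
    finally show ?thesis by simp
  qed
  then have eq: "average \<epsilon> w = (\<lambda>x. 1 * (\<lambda>x. LINT y|lborel. \<phi> (x - y) * w y) ((1 + 4 * \<epsilon>) * x + (- 2 * \<epsilon>)))"
    by auto
  have "smooth (average \<epsilon> w)"
    unfolding eq
  proof (intro smooth_affine smooth_convolution[where R=\<epsilon>] w)
    show "smooth \<phi>" unfolding \<phi>_def by (rule smooth_affine[OF smooth])
    fix z assume "\<epsilon> < \<bar>z\<bar>"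
    then show "\<phi> z = 0" using \<epsilon> by (simp add: \<phi>_def supp field_simps)
  qed
  moreover
  define K where "K = {\<epsilon> / (1 + 4 * \<epsilon>) .. (1 + 3 * \<epsilon>) / (1 + 4 * \<epsilon>)}"
  have "x \<in> K" if "average \<epsilon> w x \<noteq> 0" for x
  proof (rule ccontr)
    assume x: "x \<notin> K"
    have "b z * w ((1 + 4 * \<epsilon>) * x - 2 * \<epsilon> - \<epsilon> * z) = 0" for z
    proof (cases "1 < \<bar>z\<bar>")
      case False
      then have "\<bar>\<epsilon> * z\<bar> \<le> \<epsilon> * 1" using \<epsilon> by (simp add: abs_mult)
      moreover have "(1 + 4 * \<epsilon>) * x < \<epsilon> \<or> 1 + 3 * \<epsilon> < (1 + 4 * \<epsilon>) * x"
        using x \<epsilon> by (auto simp: K_def field_simps)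
      ultimately have "(1 + 4 * \<epsilon>) * x - 2 * \<epsilon> - \<epsilon> * z \<notin> {0<..<1}"
        by auto
      then show ?thesis using w0 by simp
    qed (simp add: supp)
    then show False using that by (simp only: average_def) simp
  qed
  then have "closure {x. average \<epsilon> w x \<noteq> 0} \<subseteq> K"
    by (intro closure_minimal) (auto simp: K_def)
  moreover have "K \<subseteq> {0<..<1}"
  proof
    fix x assume "x \<in> K"
    moreover have "0 < \<epsilon> / (1 + 4 * \<epsilon>)" "(1 + 3 * \<epsilon>) / (1 + 4 * \<epsilon>) < 1"
      using \<epsilon> by simp_all
    ultimately show "x \<in> {0<..<1}" by (simp add: K_def)
  qed
  moreover have "compact (closure {x. average \<epsilon> w x \<noteq> 0})"
    unfolding compact_eq_bounded_closed
    using bounded_subset[OF _ \<open>closure {x. average \<epsilon> w x \<noteq> 0} \<subseteq> K\<close>] by (simp add: K_def)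
  ultimately show ?thesis
    by (auto simp: test_functions_def smooth_def)
qed

lemma sq_int_average_le:
  assumes [measurable]: "w \<in> borel_measurable borel" and \<epsilon>: "0 < \<epsilon>"
  shows "sq_int lborel (average \<epsilon> w) \<le> sq_int lborel w"
proof -
  let ?X = "\<lambda>x z. (1 + 4 * \<epsilon>) * x - 2 * \<epsilon> - \<epsilon> * z"
  have "sq_int lborel (average \<epsilon> w) \<le> (\<integral>\<^sup>+x. \<integral>\<^sup>+z. ennreal (b z * (w (?X x z))\<^sup>2) \<partial>lborel \<partial>lborel)"
    unfolding sq_int_def average_def
    by (intro nn_integral_mono Jensen_square integrable nonneg integral_1) simp
  also have "\<dots> = (\<integral>\<^sup>+z. \<integral>\<^sup>+x. ennreal (b z * (w (?X x z))\<^sup>2) \<partial>lborel \<partial>lborel)"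
    by (rule lborel_pair.Fubini'[symmetric]) measurable
  also have "\<dots> \<le> (\<integral>\<^sup>+z. ennreal (b z) * sq_int lborel w \<partial>lborel)"
  proof (intro nn_integral_mono)
    fix z
    have "(\<integral>\<^sup>+x. ennreal (b z * (w (?X x z))\<^sup>2) \<partial>lborel)
        = ennreal (b z) * (\<integral>\<^sup>+x. ennreal ((w ((- 2 * \<epsilon> - \<epsilon> * z) + (1 + 4 * \<epsilon>) * x))\<^sup>2) \<partial>lborel)"
      by (simp add: ennreal_mult nonneg nn_integral_cmult algebra_simps)
    also have "\<dots> \<le> ennreal (b z) * sq_int lborel w"
      unfolding sq_int_def using \<epsilon> by (intro mult_left_mono nn_integral_affine_le) auto
    finally show "(\<integral>\<^sup>+x. ennreal (b z * (w (?X x z))\<^sup>2) \<partial>lborel) \<le> ennreal (b z) * sq_int lborel w" .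
  qed
  also have "\<dots> = sq_int lborel w"
    using integral_1 by (simp add: nn_integral_multc nn_integral_eq_integral integrable nonneg)
  finally show ?thesis .
qed


text \<open>
  By Jensen the seminorm of the average is at most the \<open>b\<close>-mean of the seminorms of the functions
  $x \mapsto w(c_z + tx)$ with $t = 1 + 4\epsilon$. Scaling multiplies each of those by $t^{2s-1}$, which is at most \<open>t\<close>.
\<close>

lemma sq_int_gap_average_le:
  assumes w: "integrable lborel w" and s: "0 < s" "s < 1" and \<epsilon>: "0 < \<epsilon>"
  shows "sq_int (lborel \<Otimes>\<^sub>M lborel) (gap (slobodeckii_weight s) (average \<epsilon> w))
       \<le> ennreal (1 + 4 * \<epsilon>) * sq_int (lborel \<Otimes>\<^sub>M lborel) (gap (slobodeckii_weight s) w)"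
proof -
  have [measurable]: "w \<in> borel_measurable borel" using w by auto
  define t where "t = 1 + 4 * \<epsilon>"
  have t: "1 \<le> t" "0 < t" using \<epsilon> by (auto simp: t_def)
  define X where "X z x = (- 2 * \<epsilon> - \<epsilon> * z) + t * x" for z x
  have [measurable]: "(\<lambda>(z, x). X z x) \<in> borel_measurable (borel \<Otimes>\<^sub>M borel)"
    unfolding X_def by measurable
  define k where "k x y = \<bar>x - y\<bar> powr (1 + 2 * s)" for x y :: real
  have [measurable]: "(\<lambda>(x, y). k x y) \<in> borel_measurable (borel \<Otimes>\<^sub>M borel)"
    unfolding k_def by measurable
  define D where "D = (\<integral>\<^sup>+x. \<integral>\<^sup>+y. ennreal ((w x - w y)\<^sup>2 / k x y) \<partial>lborel \<partial>lborel)"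
  have sq: "sq_int (lborel \<Otimes>\<^sub>M lborel) (gap (slobodeckii_weight s) u)
      = (\<integral>\<^sup>+x. \<integral>\<^sup>+y. ennreal ((u x - u y)\<^sup>2 / k x y) \<partial>lborel \<partial>lborel)"
    if [measurable]: "u \<in> borel_measurable borel" for u
  proof -
    have [measurable]: "gap (slobodeckii_weight s) u \<in> borel_measurable (borel \<Otimes>\<^sub>M borel)"
      by (rule measurable_gap) auto
    show ?thesis
      unfolding sq_int_def k_def
      by (simp add: slobodeckii_weight_square flip: lborel.nn_integral_fst)
  qed
  have avg: "average \<epsilon> w x = (LINT z|lborel. b z * w (X z x))" for x
    unfolding average_def X_def t_def by (simp add: algebra_simps)
  have int: "integrable lborel (\<lambda>z. b z * w (X z x))" for x
    using integrable_average[OF w \<epsilon>, of "t * x - 2 * \<epsilon>"] by (simp add: X_def algebra_simps)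
  have "(\<integral>\<^sup>+x. \<integral>\<^sup>+y. ennreal ((average \<epsilon> w x - average \<epsilon> w y)\<^sup>2 / k x y) \<partial>lborel \<partial>lborel)
      \<le> (\<integral>\<^sup>+x. \<integral>\<^sup>+y. \<integral>\<^sup>+z. ennreal (b z * (w (X z x) - w (X z y))\<^sup>2 / k x y) \<partial>lborel \<partial>lborel \<partial>lborel)"
  proof (intro nn_integral_mono)
    fix x y
    have "average \<epsilon> w x - average \<epsilon> w y = (LINT z|lborel. b z * (w (X z x) - w (X z y)))"
      unfolding avg by (simp add: right_diff_distrib int)
    then have "ennreal ((average \<epsilon> w x - average \<epsilon> w y)\<^sup>2)
        \<le> (\<integral>\<^sup>+z. ennreal (b z * (w (X z x) - w (X z y))\<^sup>2) \<partial>lborel)"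
      by (simp only:) (intro Jensen_square integrable nonneg integral_1, measurable)
    then have "ennreal ((average \<epsilon> w x - average \<epsilon> w y)\<^sup>2) * ennreal (1 / k x y)
        \<le> (\<integral>\<^sup>+z. ennreal (b z * (w (X z x) - w (X z y))\<^sup>2) \<partial>lborel) * ennreal (1 / k x y)"
      by (rule mult_right_mono) simp
    also have "\<dots> = (\<integral>\<^sup>+z. ennreal (b z * (w (X z x) - w (X z y))\<^sup>2) * ennreal (1 / k x y) \<partial>lborel)"
      by (rule nn_integral_multc[symmetric]) measurable
    finally show "ennreal ((average \<epsilon> w x - average \<epsilon> w y)\<^sup>2 / k x y)
        \<le> (\<integral>\<^sup>+z. ennreal (b z * (w (X z x) - w (X z y))\<^sup>2 / k x y) \<partial>lborel)"
      by (simp add: nonneg k_def flip: ennreal_mult')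
  qed
  also have "\<dots> = (\<integral>\<^sup>+x. \<integral>\<^sup>+z. \<integral>\<^sup>+y. ennreal (b z * (w (X z x) - w (X z y))\<^sup>2 / k x y) \<partial>lborel \<partial>lborel \<partial>lborel)"
    by (intro nn_integral_cong lborel_pair.Fubini') measurable
  also have "\<dots> = (\<integral>\<^sup>+z. \<integral>\<^sup>+x. \<integral>\<^sup>+y. ennreal (b z * (w (X z x) - w (X z y))\<^sup>2 / k x y) \<partial>lborel \<partial>lborel \<partial>lborel)"
    by (intro lborel_pair.Fubini') measurable
  also have "\<dots> \<le> (\<integral>\<^sup>+z. ennreal (b z) * (ennreal t * D) \<partial>lborel)"
  proof (intro nn_integral_mono)
    fix z
    have scale: "b z * (w (X z x) - w (X z y))\<^sup>2 / k x y
        = b z * (t powr (1 + 2 * s) * ((w (X z x) - w (X z y))\<^sup>2 / k (X z x) (X z y)))" for x y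
    proof -
      have "X z x - X z y = t * (x - y)" by (simp add: X_def algebra_simps)
      then have "k (X z x) (X z y) = t powr (1 + 2 * s) * k x y"
        using t by (simp add: k_def abs_mult powr_mult)
      then show ?thesis using t by simp
    qed
    define H where "H x y = ennreal ((w (X z x) - w (X z y))\<^sup>2 / k (X z x) (X z y))" for x y
    have [measurable]: "(\<lambda>(x, y). H x y) \<in> borel_measurable (borel \<Otimes>\<^sub>M borel)"
      unfolding H_def by measurable
    have "ennreal (b z * (w (X z x) - w (X z y))\<^sup>2 / k x y)
        = ennreal (b z) * (ennreal (t powr (1 + 2 * s)) * H x y)" for x y
      unfolding scale H_def
      by (simp only: ennreal_mult nonneg powr_ge_zero mult_nonneg_nonneg divide_nonneg_nonneg zero_le_power2 k_def)
    then have "(\<integral>\<^sup>+x. \<integral>\<^sup>+y. ennreal (b z * (w (X z x) - w (X z y))\<^sup>2 / k x y) \<partial>lborel \<partial>lborel)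
       = ennreal (b z) * (ennreal (t powr (1 + 2 * s)) * (\<integral>\<^sup>+x. \<integral>\<^sup>+y. H x y \<partial>lborel \<partial>lborel))"
      by (simp add: nn_integral_cmult)
    also have "\<dots> \<le> ennreal (b z) * (ennreal (t * t\<^sup>2) * (\<integral>\<^sup>+x. \<integral>\<^sup>+y. H x y \<partial>lborel \<partial>lborel))"
    proof (intro mult_left_mono mult_right_mono ennreal_leI)
      have "t powr (1 + 2 * s) \<le> t powr 3" using t s by (intro powr_mono) auto
      also have "\<dots> = t * t\<^sup>2" using t by (simp add: power3_eq_cube power2_eq_square)
      finally show "t powr (1 + 2 * s) \<le> t * t\<^sup>2" .
    qed auto
    also have "\<dots> = ennreal (b z) * (ennreal t * D)"
    proof -
      have "D = ennreal (t\<^sup>2) * (\<integral>\<^sup>+x. \<integral>\<^sup>+y. H x y \<partial>lborel \<partial>lborel)"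
        unfolding D_def H_def X_def by (rule double_nn_integral_affine) (use t in measurable)
      then show ?thesis
        using t by (simp add: ennreal_mult mult.assoc)
    qed
    finally show "(\<integral>\<^sup>+x. \<integral>\<^sup>+y. ennreal (b z * (w (X z x) - w (X z y))\<^sup>2 / k x y) \<partial>lborel \<partial>lborel)
       \<le> ennreal (b z) * (ennreal t * D)" .
  qed
  also have "\<dots> = ennreal t * D"
    using integral_1 by (simp add: nn_integral_multc nn_integral_eq_integral integrable nonneg)
  finally show ?thesis
    by (simp add: sq D_def t_def)
qed

text \<open>
  For \<open>x\<close> in the unit interval the average at \<open>x\<close> only samples \<open>w\<close> at points \<open>y\<close> with
  $|x-y| \le 3\epsilon$, where $(w(y)-w(x))^2 \le (3\epsilon)^{1+2s} (w(y)-w(x))^2/|x-y|^{1+2s}$. Undoing the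
  substitution costs a factor $1/\epsilon$ and leaves $\epsilon^{2s}$ times the seminorm.
\<close>

lemma sq_int_average_diff_le:
  assumes w: "integrable lborel w" and w0: "\<And>x. x \<notin> {0<..<1} \<Longrightarrow> w x = 0"
    and s: "0 < s" and \<epsilon>: "0 < \<epsilon>"
  shows "sq_int lborel (\<lambda>x. average \<epsilon> w x - w x)
       \<le> ennreal (M * 3 powr (1 + 2 * s) * \<epsilon> powr (2 * s)) *
          sq_int (lborel \<Otimes>\<^sub>M lborel) (gap (slobodeckii_weight s) w)"
proof -
  have [measurable]: "w \<in> borel_measurable borel" using w by auto
  have [measurable]: "gap (slobodeckii_weight s) w \<in> borel_measurable (borel \<Otimes>\<^sub>M borel)"
    by (rule measurable_gap) auto
  define F where "F x y = (w x - w y)\<^sup>2 / \<bar>x - y\<bar> powr (1 + 2 * s)" for x y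
  have [measurable]: "(\<lambda>(x, y). F x y) \<in> borel_measurable (borel \<Otimes>\<^sub>M borel)"
    unfolding F_def by measurable
  have F0: "0 \<le> F x y" for x y by (simp add: F_def)
  define C where "C = M * (3 * \<epsilon>) powr (1 + 2 * s)"
  have C: "0 \<le> C" using M_nonneg by (simp add: C_def)
  define X where "X x z = (1 + 4 * \<epsilon>) * x - 2 * \<epsilon> + (- \<epsilon>) * z" for x z
  have bound: "b z * (w (X x z) - w x)\<^sup>2 \<le> C * F x (X x z)" if x: "x \<in> {0<..<1}" for x z
  proof (cases "1 < \<bar>z\<bar> \<or> w (X x z) = w x")
    case True
    then show ?thesis using supp[of z] C F0 by auto
  next
    case False
    have "\<bar>\<epsilon> * z\<bar> \<le> \<epsilon> * 1" using False \<epsilon> by (simp add: abs_mult)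
    moreover have "\<bar>\<epsilon> * (4 * x - 2)\<bar> \<le> \<epsilon> * 2" using x \<epsilon> by (simp add: abs_mult abs_le_iff)
    ultimately have near: "\<bar>x - X x z\<bar> \<le> 3 * \<epsilon>"
      by (simp add: X_def algebra_simps)
    have pos: "0 < \<bar>x - X x z\<bar>" using False by auto
    have "(w (X x z) - w x)\<^sup>2 = \<bar>x - X x z\<bar> powr (1 + 2 * s) * F x (X x z)"
      using pos by (simp add: F_def power2_commute)
    also have "\<dots> \<le> (3 * \<epsilon>) powr (1 + 2 * s) * F x (X x z)"
      using near s F0 by (intro mult_right_mono powr_mono2) auto
    finally have "(w (X x z) - w x)\<^sup>2 \<le> (3 * \<epsilon>) powr (1 + 2 * s) * F x (X x z)" .
    then have "b z * (w (X x z) - w x)\<^sup>2 \<le> M * ((3 * \<epsilon>) powr (1 + 2 * s) * F x (X x z))"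
      using nonneg le M_nonneg by (intro mult_mono) auto
    then show ?thesis by (simp add: C_def mult.assoc)
  qed
  have "ennreal ((average \<epsilon> w x - w x)\<^sup>2) \<le> ennreal (C / \<epsilon>) * (\<integral>\<^sup>+y. ennreal (F x y) \<partial>lborel)" for x
  proof (cases "x \<in> {0<..<1}")
    case False
    have "average \<epsilon> w x = 0"
    proof -
      have "closure {x. average \<epsilon> w x \<noteq> 0} \<subseteq> {0<..<1}"
        using average_test_function[OF w w0 \<epsilon>] by (simp add: test_functions_def)
      then have "{x. average \<epsilon> w x \<noteq> 0} \<subseteq> {0<..<1}"
        by (rule order_trans[OF closure_subset])
      then show ?thesis using False by auto
    qed
    then show ?thesis using w0[OF False] by simp
  next
    case True
    have "average \<epsilon> w x - w x = (LINT z|lborel. b z * (w (X x z) - w x))"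
      using integrable_average[OF w \<epsilon>, of "(1 + 4 * \<epsilon>) * x - 2 * \<epsilon>"]
      by (simp add: average_def X_def right_diff_distrib integrable integral_1)
    then have "ennreal ((average \<epsilon> w x - w x)\<^sup>2) \<le> (\<integral>\<^sup>+z. ennreal (b z * (w (X x z) - w x)\<^sup>2) \<partial>lborel)"
      by (simp only:) (intro Jensen_square integrable nonneg integral_1, simp add: X_def)
    also have "\<dots> \<le> (\<integral>\<^sup>+z. ennreal C * ennreal (F x (X x z)) \<partial>lborel)"
      using bound[OF True] C F0 by (intro nn_integral_mono) (simp flip: ennreal_mult add: ennreal_leI)
    also have "\<dots> = ennreal (C / \<epsilon>) * (ennreal \<bar>- \<epsilon>\<bar> * (\<integral>\<^sup>+z. ennreal (F x (X x z)) \<partial>lborel))"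
    proof -
      have "ennreal C = ennreal (C / \<epsilon>) * ennreal \<bar>- \<epsilon>\<bar>"
        using C \<epsilon> by (subst ennreal_mult[symmetric]) auto
      then show ?thesis
        by (subst nn_integral_cmult) (simp_all add: X_def mult.assoc)
    qed
    also have "ennreal \<bar>- \<epsilon>\<bar> * (\<integral>\<^sup>+z. ennreal (F x (X x z)) \<partial>lborel) = (\<integral>\<^sup>+y. ennreal (F x y) \<partial>lborel)"
      unfolding X_def using \<epsilon> by (intro nn_integral_real_affine[symmetric]) auto
    finally show ?thesis .
  qed
  then have "sq_int lborel (\<lambda>x. average \<epsilon> w x - w x)
      \<le> (\<integral>\<^sup>+x. ennreal (C / \<epsilon>) * (\<integral>\<^sup>+y. ennreal (F x y) \<partial>lborel) \<partial>lborel)"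
    unfolding sq_int_def by (intro nn_integral_mono)
  also have "\<dots> = ennreal (C / \<epsilon>) * (\<integral>\<^sup>+x. \<integral>\<^sup>+y. ennreal (F x y) \<partial>lborel \<partial>lborel)"
    by (rule nn_integral_cmult) measurable
  also have "C / \<epsilon> = M * 3 powr (1 + 2 * s) * \<epsilon> powr (2 * s)"
    using \<epsilon> by (simp add: C_def powr_mult powr_add)
  also have "(\<integral>\<^sup>+x. \<integral>\<^sup>+y. ennreal (F x y) \<partial>lborel \<partial>lborel)
      = sq_int (lborel \<Otimes>\<^sub>M lborel) (gap (slobodeckii_weight s) w)"
    unfolding sq_int_def F_def
    by (simp add: slobodeckii_weight_square flip: lborel.nn_integral_fst)
  finally show ?thesis .
qed

end


text \<open>
  The widths are chosen so that $\epsilon_n^{2s} = 16^{-n}$; then the $L^2$ distances decay geometrically, which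
  yields convergence almost everywhere and hence, by the Radon-Riesz property of both
  parts of the norm, convergence in norm.
\<close>

lemma slobodeckii_sq_average_diff_tendsto_0:
  assumes [measurable]: "w \<in> borel_measurable borel" and w0: "\<And>x. x \<notin> {0<..<1} \<Longrightarrow> w x = 0"
    and s: "0 < s" "s < 1" and fin: "slobodeckii_sq s UNIV w < \<infinity>"
  shows "\<exists>T. (\<forall>n. T n \<in> test_functions {0<..<1} \<and> T n \<in> borel_measurable borel \<and> slobodeckii_sq s UNIV (T n) < \<infinity>) \<and>
    (\<lambda>n. slobodeckii_sq s UNIV (\<lambda>x. T n x - w x)) \<longlonglongrightarrow> 0"
proof -
  obtain b M where "mollifier b M"
    using exists_smooth_bump by (auto simp: mollifier_def)
  then interpret mollifier b M .
  let ?G = "gap (slobodeckii_weight s)" and ?L2 = "lborel \<Otimes>\<^sub>M lborel :: (real \<times> real) measure"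
  have gap_meas[measurable]: "?G u \<in> borel_measurable (borel \<Otimes>\<^sub>M borel)" if "u \<in> borel_measurable borel" for u
    using that by (rule measurable_gap) auto
  note slob = slobodeckii_sq_lborel
  have fin1: "sq_int lborel w < \<infinity>" and fin2: "sq_int ?L2 (?G w) < \<infinity>"
    using fin by (auto simp: slob)
  have int: "integrable lborel w"
  proof (rule Bochner_Integration.integrable_bound)
    have "integrable lborel (indicator {0<..<1::real} :: real \<Rightarrow> real)" by simp
    moreover have "integrable lborel (\<lambda>x. (w x)\<^sup>2)"
      using fin1 by (simp add: integrable_iff_bounded sq_int_def)
    ultimately show "integrable lborel (\<lambda>x. indicator {0<..<1} x + (w x)\<^sup>2)"
      by (rule Bochner_Integration.integrable_add)
    have "\<bar>a\<bar> \<le> 1 + a\<^sup>2" for a :: real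
      using sum_squares_bound[of "\<bar>a\<bar>" 1] by (simp)
    then show "AE x in lborel. norm (w x) \<le> norm (indicator {0<..<1} x + (w x)\<^sup>2)"
      using w0 by (auto simp: indicator_def)
  qed simp
  define \<epsilon> :: "nat \<Rightarrow> real" where "\<epsilon> n = ((1/16)^n) powr (1 / (2 * s))" for n
  have \<epsilon>_pos: "0 < \<epsilon> n" for n by (simp add: \<epsilon>_def)
  have \<epsilon>_powr: "\<epsilon> n powr (2 * s) = (1/16)^n" for n
    using s by (simp add: \<epsilon>_def powr_powr)
  have \<epsilon>_lim: "\<epsilon> \<longlonglongrightarrow> 0"
    unfolding \<epsilon>_def using s by (intro tendsto_zero_powrI[where b="1 / (2 * s)"] LIMSEQ_power_zero tendsto_const) auto
  define T where "T n = average (\<epsilon> n) w" for n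
  have [measurable]: "T n \<in> borel_measurable borel" for n
    unfolding T_def by measurable
  define t where "t n = 1 + 4 * \<epsilon> n" for n
  have t0: "0 \<le> t n" and t1: "1 \<le> t n" for n using \<epsilon>_pos[of n] by (auto simp: t_def)
  have t_lim: "t \<longlonglongrightarrow> 1"
    unfolding t_def using tendsto_add[OF tendsto_const tendsto_mult[OF tendsto_const \<epsilon>_lim], of 1 4] by simp
  have le1: "sq_int lborel (T n) \<le> ennreal (t n) * sq_int lborel w" for n
  proof -
    have "sq_int lborel (T n) \<le> 1 * sq_int lborel w"
      unfolding T_def using \<epsilon>_pos by (simp add: sq_int_average_le)
    also have "\<dots> \<le> ennreal (t n) * sq_int lborel w"
      using t1 by (intro mult_right_mono) auto
    finally show ?thesis .
  qed
  have le2: "sq_int ?L2 (?G (T n)) \<le> ennreal (t n) * sq_int ?L2 (?G w)" for n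
    unfolding T_def t_def using int s \<epsilon>_pos by (rule sq_int_gap_average_le)
  define K where "K = M * 3 powr (1 + 2 * s) * enn2real (sq_int ?L2 (?G w))"
  have "AE x in lborel. summable (\<lambda>n. T n x - w x)"
  proof (rule sq_int_geometric_AE_summable)
    fix n
    have "sq_int lborel (\<lambda>x. T n x - w x)
        \<le> ennreal (M * 3 powr (1 + 2 * s) * \<epsilon> n powr (2 * s)) * sq_int ?L2 (?G w)"
      unfolding T_def by (rule sq_int_average_diff_le[OF int w0 s(1) \<epsilon>_pos])
    also have "sq_int ?L2 (?G w) = ennreal (enn2real (sq_int ?L2 (?G w)))"
      using fin2 by simp
    also have "ennreal (M * 3 powr (1 + 2 * s) * \<epsilon> n powr (2 * s)) * \<dots> = ennreal (K * (1/16)^n)"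
      unfolding K_def \<epsilon>_powr by (subst ennreal_mult[symmetric]) (auto simp: M_nonneg mult_ac)
    finally show "sq_int lborel (\<lambda>x. T n x - w x) \<le> ennreal (K * (1/16)^n)" .
  qed simp
  then have AE1: "AE x in lborel. (\<lambda>n. T n x) \<longlonglongrightarrow> w x"
    by eventually_elim (rule LIM_zero_cancel[OF summable_LIMSEQ_zero])
  have AE2: "AE z in ?L2. (\<lambda>n. ?G (T n) z) \<longlonglongrightarrow> ?G w z"
  proof (rule lborel_pair.AE_pair_measure)
    show "{z \<in> space ?L2. (\<lambda>n. ?G (T n) z) \<longlonglongrightarrow> ?G w z} \<in> sets ?L2"
      by measurable
    show "AE x in lborel. AE y in lborel. (\<lambda>n. ?G (T n) (x, y)) \<longlonglongrightarrow> ?G w (x, y)"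
      using AE1
    proof eventually_elim
      case (elim x)
      show ?case
        using AE1
      proof eventually_elim
        case (elim y)
        show ?case
          unfolding gap_def prod.case by (intro tendsto_mult tendsto_diff tendsto_const elim \<open>(\<lambda>n. T n x) \<longlonglongrightarrow> w x\<close>)
      qed
    qed
  qed
  have "(\<lambda>n. sq_int lborel (\<lambda>x. T n x - w x) + sq_int ?L2 (\<lambda>z. ?G (T n) z - ?G w z)) \<longlonglongrightarrow> 0 + 0"
    by (intro tendsto_add sq_int_Radon_Riesz[where t=t] AE1 AE2 le1 le2 t0 t_lim fin1 fin2) auto
  moreover have "(\<lambda>z. ?G (T n) z - ?G w z) = ?G (\<lambda>x. T n x - w x)" for n
    by (auto simp: gap_def algebra_simps)
  ultimately have "(\<lambda>n. slobodeckii_sq s UNIV (\<lambda>x. T n x - w x)) \<longlonglongrightarrow> 0"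
    by (simp add: slob)
  moreover have "T n \<in> test_functions {0<..<1}" for n
    unfolding T_def by (rule average_test_function[OF int w0 \<epsilon>_pos])
  moreover have "slobodeckii_sq s UNIV (T n) < \<infinity>" for n
    using le_less_trans[OF le1[of n]] le_less_trans[OF le2[of n]] fin1 fin2
    by (simp add: slob ennreal_mult_less_top)
  ultimately show ?thesis by (intro exI[of _ T]) auto
qed

text \<open>
  Any representative of \<open>w\<close> may be replaced by a Borel function that vanishes identically outside the
  interval, since \<^const>\<open>H_norm\<close> only sees classes modulo null sets.
\<close>

lemma H0_tilde_unit_interval:
  assumes s: "0 < s" "s < 1"
    and w: "w \<in> borel_measurable lebesgue" and w0: "AE x in lebesgue. x \<notin> {0<..<1} \<longrightarrow> w x = 0"
    and fin: "slobodeckii_sq s UNIV w < \<infinity>"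
  shows "w \<in> H0_tilde s {0<..<1}"
proof -
  obtain w' where [measurable]: "w' \<in> borel_measurable borel" and ae: "AE x in lborel. w x = w' x"
    using completion_ex_borel_measurable_real[OF w] by auto
  define v where "v x = indicator {0<..<1} x * w' x" for x
  have [measurable]: "v \<in> borel_measurable borel" unfolding v_def by measurable
  have v0: "v x = 0" if "x \<notin> {0<..<1}" for x using that by (simp add: v_def)
  have wv: "AE x in lebesgue. w x = v x"
    using AE_completion[OF ae] w0 by eventually_elim (auto simp: v_def indicator_def)
  have fin': "slobodeckii_sq s UNIV v < \<infinity>"
    using fin slobodeckii_sq_cong_AE[OF wv] by simp
  obtain T where T: "\<And>n. T n \<in> test_functions {0<..<1}" "\<And>n. T n \<in> borel_measurable borel"
      "\<And>n. slobodeckii_sq s UNIV (T n) < \<infinity>"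
    and lim: "(\<lambda>n. slobodeckii_sq s UNIV (\<lambda>x. T n x - v x)) \<longlonglongrightarrow> 0"
    using slobodeckii_sq_average_diff_tendsto_0[OF _ v0 s fin'] by auto
  have "slobodeckii_sq s UNIV (\<lambda>x. w x - T n x) = slobodeckii_sq s UNIV (\<lambda>x. T n x - v x)" for n
  proof -
    have "slobodeckii_sq s UNIV (\<lambda>x. w x - T n x) = slobodeckii_sq s UNIV (\<lambda>x. v x - T n x)"
      by (rule slobodeckii_sq_cong_AE) (use wv in \<open>eventually_elim, simp\<close>)
    also have "\<dots> = slobodeckii_sq s UNIV (\<lambda>x. T n x - v x)"
    proof -
      have "((v x - T n x) - (v y - T n y))\<^sup>2 = ((T n x - v x) - (T n y - v y))\<^sup>2" for x y
        by (simp add: power2_eq_square algebra_simps)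
      then show ?thesis
        unfolding slobodeckii_sq_def by (simp add: power2_commute)
    qed
    finally show ?thesis .
  qed
  then have "(\<lambda>n. H_norm s UNIV (\<lambda>x. w x - T n x)) \<longlonglongrightarrow> sqrt (enn2real 0)"
    unfolding H_norm_def using lim by (intro tendsto_real_sqrt tendsto_enn2real) auto
  then have lim': "(\<lambda>n. H_norm s UNIV (\<lambda>x. w x - T n x)) \<longlonglongrightarrow> 0" by simp
  have "w \<in> H_space s UNIV"
    using w fin by (simp add: H_space_def lebesgue_on_UNIV_eq)
  moreover have "T n \<in> H_space s UNIV" for n
    using T[of n] by (simp add: H_space_def lebesgue_on_UNIV_eq measurable_completion)
  moreover have "\<exists>n. H_norm s UNIV (\<lambda>x. w x - T n x) < \<epsilon>" if "0 < \<epsilon>" for \<epsilon>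
    using order_tendstoD(2)[OF lim' that] by (auto simp: eventually_sequentially)
  ultimately show ?thesis
    unfolding H0_tilde_def H_closure_def using T(1) by blast
qed

section \<open>The energy form\<close>

lemma sigma_finite_lebesgue: "sigma_finite_measure (lebesgue :: real measure)"
proof
  obtain A :: "real set set" where A: "countable A" "A \<subseteq> sets lborel" "\<Union>A = space lborel" "\<forall>a\<in>A. emeasure lborel a \<noteq> \<infinity>"
    using lborel.sigma_finite_countable by blast
  then show "\<exists>A. countable A \<and> A \<subseteq> sets lebesgue \<and> \<Union>A = space (lebesgue :: real measure) \<and> (\<forall>a\<in>A. emeasure lebesgue a \<noteq> \<infinity>)"
    by (intro exI[of _ A]) auto
qed

interpretation lebesgue: sigma_finite_measure "lebesgue :: real measure"
  by (rule sigma_finite_lebesgue)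

interpretation lebesgue_pair: pair_sigma_finite "lebesgue :: real measure" "lebesgue :: real measure" ..

abbreviation lebesgue2 :: "(real \<times> real) measure" where
  "lebesgue2 \<equiv> lebesgue \<Otimes>\<^sub>M lebesgue"

lemma measurable_lebesgue2:
  assumes "f \<in> borel_measurable (borel \<Otimes>\<^sub>M borel)"
  shows "f \<in> borel_measurable lebesgue2"
proof -
  have [measurable]: "(\<lambda>x. x) \<in> lebesgue \<rightarrow>\<^sub>M (borel :: real measure)"
    by (rule measurable_completion) simp
  have "(\<lambda>z. (fst z, snd z)) \<in> lebesgue2 \<rightarrow>\<^sub>M borel \<Otimes>\<^sub>M borel"
    by (intro measurable_Pair measurable_compose[OF measurable_fst] measurable_compose[OF measurable_snd]) auto
  from measurable_compose[OF this assms] show ?thesis by simp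
qed

lemma slobodeckii_sq_lebesgue:
  assumes [measurable]: "u \<in> borel_measurable lebesgue"
  shows "slobodeckii_sq s UNIV u = sq_int lebesgue u + sq_int lebesgue2 (gap (slobodeckii_weight s) u)"
proof -
  have [measurable]: "gap (slobodeckii_weight s) u \<in> borel_measurable lebesgue2"
    by (intro measurable_gap measurable_lebesgue2) auto
  show ?thesis
    unfolding slobodeckii_sq_def sq_int_def
    by (simp add: lebesgue_on_UNIV_eq slobodeckii_weight_square flip: lebesgue.nn_integral_fst)
qed

lemma gap_lin: "gap k (\<lambda>x. a * u x + b * v x) z = a * gap k u z + b * gap k v z"
  by (cases z) (simp add: gap_def algebra_simps)

lemma gap_diff: "gap k (\<lambda>x. u x - v x) z = gap k u z - gap k v z"
  by (cases z) (simp add: gap_def algebra_simps)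

text \<open>
  In the tempered case \<open>- \<beta>\<close> lies strictly between -2 and 0 and differs from -1, so it avoids the poles of
  the Gamma function, at which \<^const>\<open>Gamma\<close> has the value 0.
\<close>

lemma tempered_const_pos:
  assumes "0 < \<beta>" "\<beta> < 2"
  shows "0 < tempered_const \<beta> lam"
proof (cases "lam = 0 \<or> \<beta> = 1")
  case True
  then show ?thesis
    unfolding tempered_const_def using assms by (auto intro!: divide_pos_pos mult_pos_pos Gamma_real_pos)
next
  case False
  have "Gamma (- \<beta>) \<noteq> 0"
  proof
    assume "Gamma (- \<beta>) = 0"
    then obtain n where "- \<beta> = - real n"
      by (auto simp: Gamma_eq_zero_iff elim!: nonpos_Ints_cases')
    then have "\<beta> = real n" by simp
    with assms have "n = 1" by simp
    then show False using False \<open>\<beta> = real n\<close> by simp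
  qed
  then show ?thesis
    unfolding tempered_const_def using False by (auto intro!: divide_pos_pos mult_pos_pos Gamma_real_pos)
qed

text \<open>
  The untempered kernel $|z|^{-1-\beta}$ cut off near its singularity; what remains is integrable.
\<close>

definition tail :: "real \<Rightarrow> real \<Rightarrow> real" where
  "tail \<beta> z = (if 1 < \<bar>z\<bar> then \<bar>z\<bar> powr (- (1 + \<beta>)) else 0)"

lemma measurable_tail[measurable]: "tail \<beta> \<in> borel_measurable borel"
  unfolding tail_def by measurable

lemma nn_integral_tail_finite:
  assumes "0 < \<beta>"
  shows "(\<integral>\<^sup>+z. ennreal (tail \<beta> z) \<partial>lborel) < \<infinity>"
proof -
  define h where "h z = ennreal (z powr (- (1 + \<beta>))) * indicator {1..} z" for z :: real
  have [measurable]: "h \<in> borel_measurable borel" unfolding h_def by measurable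
  have "((\<lambda>z::real. - (z powr (- \<beta>)) / \<beta>) \<longlongrightarrow> - 0 / \<beta>) at_top"
    using assms by (intro tendsto_intros tendsto_neg_powr filterlim_ident) auto
  then have "(\<integral>\<^sup>+z. h z \<partial>lborel) = ennreal (0 - (- (1 powr (- \<beta>)) / \<beta>))"
    unfolding h_def
  proof (intro nn_integral_FTC_atLeast)
    fix z :: real assume "1 \<le> z"
    then show "((\<lambda>z. - (z powr (- \<beta>)) / \<beta>) has_real_derivative z powr (- (1 + \<beta>))) (at z)"
      using assms by (auto intro!: derivative_eq_intros simp: field_simps powr_diff powr_minus powr_add)
  qed auto
  then have h: "(\<integral>\<^sup>+z. h z \<partial>lborel) < \<infinity>" by simp
  have "(\<integral>\<^sup>+z. ennreal (tail \<beta> z) \<partial>lborel) \<le> (\<integral>\<^sup>+z. h z + h (0 + (- 1) * z) \<partial>lborel)"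
    by (intro nn_integral_mono) (auto simp: tail_def h_def indicator_def)
  also have "\<dots> = (\<integral>\<^sup>+z. h z \<partial>lborel) + (\<integral>\<^sup>+z. h (0 + (- 1) * z) \<partial>lborel)"
    by (intro nn_integral_add) auto
  also have "(\<integral>\<^sup>+z. h (0 + (- 1) * z) \<partial>lborel) = (\<integral>\<^sup>+z. h z \<partial>lborel)"
    using nn_integral_real_affine[of h "-1" 0] by simp
  finally show ?thesis using h by (auto intro: le_less_trans)
qed

lemma nn_integral_tail_shift:
  "(\<integral>\<^sup>+y. ennreal (tail \<beta> (x - y)) \<partial>lebesgue) = (\<integral>\<^sup>+z. ennreal (tail \<beta> z) \<partial>lborel)"
  using nn_integral_real_affine[of "\<lambda>z. ennreal (tail \<beta> z)" "-1" x]
  by (simp add: nn_integral_completion)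

locale tempered_problem =
  fixes \<beta> lam :: real and \<Omega> :: "real set"
  assumes \<beta>: "0 < \<beta>" "\<beta> < 2" and lam: "0 \<le> lam" and \<Omega>_eq: "\<Omega> = {0<..<1}"
begin

text \<open>
  Square root of the tempered kernel, set to zero on pairs with both entries outside \<open>\<Omega>\<close>. An
  admissible extension is under control only on the other pairs.
\<close>

definition weight :: "real \<times> real \<Rightarrow> real" where
  "weight = (\<lambda>(x, y). if x \<in> \<Omega> \<or> y \<in> \<Omega>
     then exp (- (lam * \<bar>x - y\<bar> / 2)) * slobodeckii_weight (\<beta> / 2) (x, y) else 0)"

abbreviation energy :: "(real \<Rightarrow> real) \<Rightarrow> ennreal" where
  "energy p \<equiv> sq_int lebesgue2 (gap weight p)"

definition finite_energy :: "(real \<Rightarrow> real) set" where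
  "finite_energy = {p \<in> borel_measurable lebesgue. energy p < \<infinity>}"

definition form :: "(real \<Rightarrow> real) \<Rightarrow> (real \<Rightarrow> real) \<Rightarrow> real" where
  "form p v = (LINT z|lebesgue2. gap weight p z * gap weight v z)"

definition energy_space :: "(real \<Rightarrow> real) set" where
  "energy_space = {p \<in> finite_energy. AE x in lebesgue. x \<notin> \<Omega> \<longrightarrow> p x = 0}"

lemma sets_\<Omega>[measurable]: "\<Omega> \<in> sets borel"
  by (simp add: \<Omega>_eq)

lemma measurable_weight[measurable]: "weight \<in> borel_measurable lebesgue2"
  by (rule measurable_lebesgue2) (unfold weight_def, measurable)

lemma measurable_gap_weight[measurable]:
  "p \<in> borel_measurable lebesgue \<Longrightarrow> gap weight p \<in> borel_measurable lebesgue2"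
  by (rule measurable_gap) auto

lemma gap_weight_mult:
  "gap weight p (x, y) * gap weight v (x, y) =
     (if x \<in> \<Omega> \<or> y \<in> \<Omega> then (p x - p y) * (v x - v y) / (exp (lam * \<bar>x - y\<bar>) * \<bar>x - y\<bar> powr (1 + \<beta>)) else 0)"
proof -
  have "(\<bar>x - y\<bar> powr (- (1 / 2 + \<beta> / 2))) * (\<bar>x - y\<bar> powr (- (1 / 2 + \<beta> / 2))) = 1 / \<bar>x - y\<bar> powr (1 + \<beta>)"
    by (simp flip: powr_add powr_minus_divide)
  moreover have "exp (- (lam * \<bar>x - y\<bar> / 2)) * exp (- (lam * \<bar>x - y\<bar> / 2)) = 1 / exp (lam * \<bar>x - y\<bar>)"
    by (simp add: exp_minus inverse_eq_divide flip: exp_add)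
  ultimately have "(exp (- (lam * \<bar>x - y\<bar> / 2)) * \<bar>x - y\<bar> powr (- (1 / 2 + \<beta> / 2))) *
      (exp (- (lam * \<bar>x - y\<bar> / 2)) * \<bar>x - y\<bar> powr (- (1 / 2 + \<beta> / 2)))
      = 1 / (exp (lam * \<bar>x - y\<bar>) * \<bar>x - y\<bar> powr (1 + \<beta>))"
    by (simp only: mult.assoc mult.left_commute[of "\<bar>x - y\<bar> powr _" "exp _"]) simp
  then show ?thesis
    unfolding gap_def weight_def slobodeckii_weight_def prod.case
    by (simp only: if_distrib[of "\<lambda>z. _ * z"] mult.assoc mult.left_commute) (simp add: mult_ac)
qed

lemma finite_energy_lin:
  assumes "u \<in> finite_energy" "v \<in> finite_energy"
  shows "(\<lambda>x. a * u x + b * v x) \<in> finite_energy"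
  using assms sq_int_lin_finite[of "gap weight u" lebesgue2 "gap weight v" a b]
  by (auto simp: finite_energy_def gap_lin[abs_def] measurable_gap_weight)

lemma integrable_gap_mult:
  assumes "u \<in> finite_energy" "v \<in> finite_energy"
  shows "integrable lebesgue2 (\<lambda>z. gap weight u z * gap weight v z)"
  using assms unfolding finite_energy_def by (intro integrable_mult_sq_int) auto

lemma energy_eq_form: "p \<in> finite_energy \<Longrightarrow> energy p = ennreal (form p p)"
  unfolding finite_energy_def form_def by (intro sq_int_eq_integral) auto

lemma form_nonneg: "0 \<le> form p p"
  unfolding form_def by (rule integral_nonneg_AE) simp

lemma form_sym: "form u v = form v u"
  by (simp add: form_def mult.commute)

lemma form_lin:
  assumes "u \<in> finite_energy" "v \<in> finite_energy" "w \<in> finite_energy"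
  shows "form (\<lambda>x. a * u x + b * v x) w = a * form u w + b * form v w"
  using integrable_gap_mult[OF assms(1,3)] integrable_gap_mult[OF assms(2,3)]
  by (simp add: form_def gap_lin distrib_right mult.assoc)

lemma form_Cauchy_Schwarz:
  assumes "u \<in> finite_energy" "v \<in> finite_energy"
  shows "\<bar>form u v\<bar> \<le> sqrt (form u u) * sqrt (form v v)"
proof -
  have "(form u v)\<^sup>2 \<le> form u u * form v v"
  proof (rule discriminant_nonpos)
    fix t
    let ?q = "\<lambda>x. 1 * u x + t * v x"
    have q: "?q \<in> finite_energy" by (rule finite_energy_lin[OF assms])
    have 1: "form ?q ?q = 1 * form u ?q + t * form v ?q" by (rule form_lin[OF assms q])
    have 2: "form u ?q = 1 * form u u + t * form v u"
      unfolding form_sym[of u ?q] by (rule form_lin[OF assms assms(1)])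
    have 3: "form v ?q = 1 * form u v + t * form v v"
      unfolding form_sym[of v ?q] by (rule form_lin[OF assms assms(2)])
    have "form u u + 2 * t * form u v + t\<^sup>2 * form v v = form ?q ?q"
      unfolding 1 2 3 by (simp add: form_sym[of v u] power2_eq_square algebra_simps)
    then show "0 \<le> form u u + 2 * t * form u v + t\<^sup>2 * form v v"
      by (simp only: form_nonneg)
  qed (rule form_nonneg)
  then have "\<bar>form u v\<bar> \<le> sqrt (form u u * form v v)"
    by (intro real_le_rsqrt) simp
  then show ?thesis by (simp add: real_sqrt_mult)
qed

text \<open>
  Since \<open>v\<close> vanishes outside \<open>\<Omega>\<close>, the pairs discarded in \<^const>\<open>weight\<close> contribute nothing; the
  integrand is integrable over the plane, so Fubini turns the iterated integral into a double integral.
\<close>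

lemma tempered_form_eq:
  assumes p: "p \<in> finite_energy" and v: "v \<in> energy_space"
  shows "tempered_form \<beta> lam p v = tempered_const \<beta> lam / 2 * form p v"
proof -
  let ?f = "\<lambda>(x, y). (p x - p y) * (v x - v y) / (exp (lam * \<bar>x - y\<bar>) * \<bar>x - y\<bar> powr (1 + \<beta>))"
  let ?g = "\<lambda>z. gap weight p z * gap weight v z"
  have vE: "v \<in> finite_energy" and v0: "AE x in lebesgue. x \<notin> \<Omega> \<longrightarrow> v x = 0"
    using v by (auto simp: energy_space_def)
  have [measurable]: "p \<in> borel_measurable lebesgue" "v \<in> borel_measurable lebesgue"
    using p vE by (auto simp: finite_energy_def)
  have [measurable]: "(\<lambda>(x, y). exp (lam * \<bar>x - y\<bar>) * \<bar>x - y\<bar> powr (1 + \<beta>)) \<in> borel_measurable lebesgue2"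
    by (rule measurable_lebesgue2) measurable
  have [measurable]: "?f \<in> borel_measurable lebesgue2"
  proof -
    have "(\<lambda>z. (p (fst z) - p (snd z)) * (v (fst z) - v (snd z)) /
        (\<lambda>(x, y). exp (lam * \<bar>x - y\<bar>) * \<bar>x - y\<bar> powr (1 + \<beta>)) z) \<in> borel_measurable lebesgue2"
      by measurable
    then show ?thesis by (simp add: case_prod_beta')
  qed
  define f where "f = ?f"
  define g where "g = ?g"
  have [measurable]: "f \<in> borel_measurable lebesgue2" "g \<in> borel_measurable lebesgue2"
    using \<open>?f \<in> borel_measurable lebesgue2\<close> by (auto simp: f_def g_def)
  have eq: "g (x, y) = f (x, y)" if "x \<notin> \<Omega> \<longrightarrow> v x = 0" "y \<notin> \<Omega> \<longrightarrow> v y = 0" for x y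
    using that by (auto simp: f_def g_def gap_weight_mult)
  have ae: "AE z in lebesgue2. g z = f z"
  proof (rule lebesgue_pair.AE_pair_measure)
    show "{z \<in> space lebesgue2. g z = f z} \<in> sets lebesgue2" by measurable
    have "AE y in lebesgue. g (x, y) = f (x, y)" if "x \<notin> \<Omega> \<longrightarrow> v x = 0" for x
      using v0 by (rule eventually_mono) (rule eq[OF that])
    then show "AE x in lebesgue. AE y in lebesgue. g (x, y) = f (x, y)"
      using v0 by (rule eventually_mono[rotated])
  qed
  have gi: "integrable lebesgue2 g"
    unfolding g_def by (rule integrable_gap_mult[OF p vE])
  have "integrable lebesgue2 f"
    by (rule integrable_cong_AE_imp[OF gi _ ae]) measurable
  then have "(LINT x|lebesgue. LINT y|lebesgue. f (x, y)) = integral\<^sup>L lebesgue2 f"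
    by (rule lebesgue_pair.integral_fst')
  also have "\<dots> = integral\<^sup>L lebesgue2 g"
    by (rule integral_cong_AE[symmetric, OF _ _ ae]) measurable
  finally show ?thesis by (simp add: tempered_form_def form_def f_def g_def)
qed

end

section \<open>Coercivity\<close>

context tempered_problem begin

lemma gap_weight_le: "(gap weight p z)\<^sup>2 \<le> (gap (slobodeckii_weight (\<beta> / 2)) p z)\<^sup>2"
proof (cases z)
  case (Pair x y)
  show ?thesis
    using lam unfolding Pair gap_def weight_def prod.case power_mult_distrib
    by (intro mult_left_mono power_mono) (auto simp: slobodeckii_weight_def mult_left_le_one_le)
qed

text \<open>
  The pairs meeting \<open>\<Omega>\<close> are covered by $\Omega \times R$ and $R \times \Omega$, and by symmetry of the kernel
  both contribute the integral that is finite by admissibility.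
\<close>

lemma admissible_finite_energy:
  assumes \<eta>: "admissible_extension \<beta> \<Omega> g \<eta>"
  shows "\<eta> \<in> finite_energy"
proof -
  have meas[measurable]: "\<eta> \<in> borel_measurable lebesgue"
    and fin: "(\<integral>\<^sup>+y. \<integral>\<^sup>+x. ennreal ((\<eta> x - \<eta> y)\<^sup>2 / \<bar>x - y\<bar> powr (1 + \<beta>)) \<partial>lebesgue \<partial>lebesgue_on \<Omega>) < \<infinity>"
    using \<eta> by (auto simp: admissible_extension_def)
  have [measurable]: "gap (slobodeckii_weight (\<beta> / 2)) \<eta> \<in> borel_measurable lebesgue2"
    by (intro measurable_gap measurable_lebesgue2) auto
  define F where "F z = ennreal ((gap (slobodeckii_weight (\<beta> / 2)) \<eta> z)\<^sup>2)" for z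
  have [measurable]: "F \<in> borel_measurable lebesgue2" unfolding F_def by measurable
  have F: "F (x, y) = ennreal ((\<eta> x - \<eta> y)\<^sup>2 / \<bar>x - y\<bar> powr (1 + \<beta>))" for x y
    by (simp add: F_def slobodeckii_weight_square)
  have F_sym: "F (x, y) = F (y, x)" for x y
    by (simp add: F power2_commute abs_minus_commute)
  define A where "A = (\<integral>\<^sup>+y. (\<integral>\<^sup>+x. F (x, y) \<partial>lebesgue) * indicator \<Omega> y \<partial>lebesgue)"
  have "A < \<infinity>"
    using fin unfolding A_def F by (simp add: nn_integral_restrict_space)
  have [measurable]: "(\<lambda>z. indicator \<Omega> (fst z) :: ennreal) \<in> borel_measurable lebesgue2"
    by (rule measurable_lebesgue2) measurable
  have [measurable]: "(\<lambda>z. indicator \<Omega> (snd z) :: ennreal) \<in> borel_measurable lebesgue2"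
    by (rule measurable_lebesgue2) measurable
  have A1: "(\<integral>\<^sup>+z. F z * indicator \<Omega> (snd z) \<partial>lebesgue2) = A"
    unfolding A_def by (subst lebesgue_pair.nn_integral_snd[symmetric]) (auto simp: nn_integral_multc)
  have A2: "(\<integral>\<^sup>+z. F z * indicator \<Omega> (fst z) \<partial>lebesgue2) = A"
    unfolding A_def by (subst lebesgue.nn_integral_fst[symmetric]) (auto simp: nn_integral_multc F_sym)
  have "energy \<eta> \<le> (\<integral>\<^sup>+z. F z * indicator \<Omega> (fst z) + F z * indicator \<Omega> (snd z) \<partial>lebesgue2)"
    unfolding sq_int_def
  proof (intro nn_integral_mono)
    fix z :: "real \<times> real"
    obtain x y where z: "z = (x, y)" by fastforce
    have "ennreal ((gap weight \<eta> z)\<^sup>2) \<le> F z"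
      unfolding F_def by (rule ennreal_leI[OF gap_weight_le])
    moreover have "gap weight \<eta> z = 0" if "x \<notin> \<Omega>" "y \<notin> \<Omega>"
      using that by (simp add: z gap_def weight_def)
    ultimately show "ennreal ((gap weight \<eta> z)\<^sup>2) \<le> F z * indicator \<Omega> (fst z) + F z * indicator \<Omega> (snd z)"
      by (cases "x \<in> \<Omega>"; cases "y \<in> \<Omega>") (auto simp: z indicator_def intro: order_trans)
  qed
  also have "\<dots> = A + A"
    by (subst nn_integral_add) (auto simp: A1 A2)
  finally show ?thesis
    using \<open>A < \<infinity>\<close> meas by (auto simp: finite_energy_def intro: le_less_trans)
qed

lemma slobodeckii_finite_energy:
  assumes "p \<in> borel_measurable lebesgue" "slobodeckii_sq (\<beta> / 2) UNIV p < \<infinity>"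
  shows "p \<in> finite_energy"
proof -
  have "energy p \<le> sq_int lebesgue2 (gap (slobodeckii_weight (\<beta> / 2)) p)"
    unfolding sq_int_def by (intro nn_integral_mono ennreal_leI gap_weight_le)
  also have "\<dots> \<le> slobodeckii_sq (\<beta> / 2) UNIV p"
    by (simp add: slobodeckii_sq_lebesgue assms(1))
  finally show ?thesis using assms by (simp add: finite_energy_def)
qed

text \<open>
  For \<open>x \<in> \<Omega>\<close> and \<open>y\<close> between 1 and 2 the function vanishes at \<open>y\<close> and the distance is at most 2, so
  the energy density is at least $p(x)^2 e^{-2\lambda} 2^{-1-\beta}$; integrate over \<open>y\<close>.
\<close>

lemma Poincare:
  assumes [measurable]: "p \<in> borel_measurable lebesgue" and p0: "AE x in lebesgue. x \<notin> \<Omega> \<longrightarrow> p x = 0"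
  shows "sq_int lebesgue p \<le> ennreal (exp (lam * 2) * 2 powr (1 + \<beta>)) * energy p"
proof -
  define C where "C = exp (lam * 2) * 2 powr (1 + \<beta>)"
  have C: "0 < C" by (simp add: C_def)
  have "sq_int lebesgue p = (\<integral>\<^sup>+x. \<integral>\<^sup>+y. ennreal ((p x)\<^sup>2) * indicator {1<..<2::real} y \<partial>lebesgue \<partial>lebesgue)"
    unfolding sq_int_def by (simp add: nn_integral_cmult_indicator)
  also have "\<dots> \<le> (\<integral>\<^sup>+x. \<integral>\<^sup>+y. ennreal C * ennreal ((gap weight p (x, y))\<^sup>2) \<partial>lebesgue \<partial>lebesgue)"
  proof (rule nn_integral_mono_AE, use p0 in eventually_elim)
    fix x assume x: "x \<notin> \<Omega> \<longrightarrow> p x = 0"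
    have "AE y in lebesgue. ennreal ((p x)\<^sup>2) * indicator {1<..<2::real} y \<le> ennreal C * ennreal ((gap weight p (x, y))\<^sup>2)"
      using p0
    proof eventually_elim
      case (elim y)
      show ?case
      proof (cases "x \<in> \<Omega> \<and> y \<in> {1<..<2}")
        case True
        then have xy: "0 < \<bar>x - y\<bar>" "\<bar>x - y\<bar> \<le> 2" and py: "p y = 0"
          using elim by (auto simp: \<Omega>_eq)
        have "(gap weight p (x, y))\<^sup>2 = (p x)\<^sup>2 / (exp (lam * \<bar>x - y\<bar>) * \<bar>x - y\<bar> powr (1 + \<beta>))"
          using True py by (simp add: power2_eq_square gap_weight_mult)
        moreover have "exp (lam * \<bar>x - y\<bar>) * \<bar>x - y\<bar> powr (1 + \<beta>) \<le> C"
          unfolding C_def using xy lam \<beta> by (intro mult_mono powr_mono2) (auto intro: mult_left_mono)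
        moreover have "0 < exp (lam * \<bar>x - y\<bar>) * \<bar>x - y\<bar> powr (1 + \<beta>)" using xy by simp
        ultimately have "(p x)\<^sup>2 \<le> C * (gap weight p (x, y))\<^sup>2"
          using mult_right_mono[of "exp (lam * \<bar>x - y\<bar>) * \<bar>x - y\<bar> powr (1 + \<beta>)" C "(gap weight p (x, y))\<^sup>2"] xy
          by (auto split: if_splits)
        then show ?thesis using True C by (simp flip: ennreal_mult add: ennreal_leI)
      qed (use x in \<open>auto simp: indicator_def\<close>)
    qed
    then show "(\<integral>\<^sup>+y. ennreal ((p x)\<^sup>2) * indicator {1<..<2::real} y \<partial>lebesgue)
        \<le> (\<integral>\<^sup>+y. ennreal C * ennreal ((gap weight p (x, y))\<^sup>2) \<partial>lebesgue)"
      by (rule nn_integral_mono_AE)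
  qed
  also have "\<dots> = (\<integral>\<^sup>+z. ennreal C * ennreal ((gap weight p z)\<^sup>2) \<partial>lebesgue2)"
    by (rule lebesgue.nn_integral_fst) measurable
  also have "\<dots> = ennreal C * energy p"
    unfolding sq_int_def by (rule nn_integral_cmult) measurable
  finally show ?thesis by (simp only: C_def)
qed

text \<open>
  At distance at most 1 the tempering factor is at least $e^{-\lambda}$; at larger distance the difference
  is estimated by the two values, and the kernel by its integrable tail.
\<close>

lemma coercive_weight:
  assumes x: "x \<notin> \<Omega> \<longrightarrow> p x = 0" and y: "y \<notin> \<Omega> \<longrightarrow> p y = 0"
  shows "(gap (slobodeckii_weight (\<beta> / 2)) p (x, y))\<^sup>2
    \<le> exp lam * (gap weight p (x, y))\<^sup>2 + 2 * (p x)\<^sup>2 * tail \<beta> (x - y) + 2 * (p y)\<^sup>2 * tail \<beta> (x - y)"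
proof (cases "1 < \<bar>x - y\<bar>")
  case True
  have "(p x - p y)\<^sup>2 \<le> 2 * (p x)\<^sup>2 + 2 * (p y)\<^sup>2"
    using zero_le_power2[of "p x + p y"] by (simp add: power2_sum power2_diff)
  then have "(p x - p y)\<^sup>2 * tail \<beta> (x - y) \<le> (2 * (p x)\<^sup>2 + 2 * (p y)\<^sup>2) * tail \<beta> (x - y)"
    by (rule mult_right_mono) (simp add: tail_def)
  moreover have "(gap (slobodeckii_weight (\<beta> / 2)) p (x, y))\<^sup>2 = (p x - p y)\<^sup>2 * tail \<beta> (x - y)"
  proof -
    have "tail \<beta> (x - y) = 1 / \<bar>x - y\<bar> powr (1 + \<beta>)"
      unfolding tail_def powr_minus_divide using True by simp
    then show ?thesis by (simp add: slobodeckii_weight_square)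
  qed
  moreover have "0 \<le> exp lam * (gap weight p (x, y))\<^sup>2" by simp
  ultimately show ?thesis
    unfolding distrib_right by linarith
next
  case near: False
  have "(gap (slobodeckii_weight (\<beta> / 2)) p (x, y))\<^sup>2 \<le> exp lam * (gap weight p (x, y))\<^sup>2"
  proof (cases "x \<in> \<Omega> \<or> y \<in> \<Omega>")
    case True
    have "1 \<le> exp (lam - lam * \<bar>x - y\<bar>)"
      using near lam by (simp add: mult_left_le)
    from mult_right_mono[OF this, of "(p x - p y)\<^sup>2 / \<bar>x - y\<bar> powr (1 + \<beta>)"]
    have "(p x - p y)\<^sup>2 / \<bar>x - y\<bar> powr (1 + \<beta>) \<le> exp (lam - lam * \<bar>x - y\<bar>) * ((p x - p y)\<^sup>2 / \<bar>x - y\<bar> powr (1 + \<beta>))"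
      by simp
    also have "\<dots> = exp lam * (gap weight p (x, y))\<^sup>2"
      using True by (simp add: power2_eq_square gap_weight_mult exp_diff)
    finally show ?thesis by (simp add: slobodeckii_weight_square)
  qed (use x y in \<open>simp add: gap_def\<close>)
  then show ?thesis using near by (simp add: tail_def)
qed

text \<open>
  Integrated over the plane, each of the two tail terms of \<open>coercive_weight\<close> is a constant times the
  square of the $L^2$ norm, because the integral of the shifted tail does not depend on the shift.
  \<open>Poincare\<close> bounds that norm by the energy.
\<close>

lemma coercive:
  "\<exists>C\<ge>0. \<forall>p \<in> borel_measurable lebesgue. (AE x in lebesgue. x \<notin> \<Omega> \<longrightarrow> p x = 0) \<longrightarrow>
      slobodeckii_sq (\<beta> / 2) UNIV p \<le> ennreal C * energy p"
proof -
  define C1 where "C1 = exp (lam * 2) * 2 powr (1 + \<beta>)"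
  define K where "K = enn2real (\<integral>\<^sup>+z. ennreal (tail \<beta> z) \<partial>lborel)"
  have K: "(\<integral>\<^sup>+z. ennreal (tail \<beta> z) \<partial>lborel) = ennreal K"
    using nn_integral_tail_finite[OF \<beta>(1)] by (simp add: K_def)
  have nonneg: "0 \<le> C1" "0 \<le> K" by (auto simp: C1_def K_def)
  have "slobodeckii_sq (\<beta> / 2) UNIV p \<le> ennreal (C1 + exp lam + 4 * K * C1) * energy p"
    if p[measurable]: "p \<in> borel_measurable lebesgue" and p0: "AE x in lebesgue. x \<notin> \<Omega> \<longrightarrow> p x = 0" for p
  proof -
    have [measurable]: "gap (slobodeckii_weight (\<beta> / 2)) p \<in> borel_measurable lebesgue2"
      by (intro measurable_gap measurable_lebesgue2) auto
    have [measurable]: "(\<lambda>z. tail \<beta> (fst z - snd z)) \<in> borel_measurable lebesgue2"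
      by (rule measurable_lebesgue2) measurable
    have tail0: "0 \<le> tail \<beta> z" for z by (simp add: tail_def)
    define G where "G z = exp lam * (gap weight p z)\<^sup>2 + 2 * (p (fst z))\<^sup>2 * tail \<beta> (fst z - snd z)
        + 2 * (p (snd z))\<^sup>2 * tail \<beta> (fst z - snd z)" for z
    have [measurable]: "G \<in> borel_measurable lebesgue2" unfolding G_def by measurable
    have "AE z in lebesgue2. (gap (slobodeckii_weight (\<beta> / 2)) p z)\<^sup>2 \<le> G z"
    proof (rule lebesgue_pair.AE_pair_measure)
      show "{z \<in> space lebesgue2. (gap (slobodeckii_weight (\<beta> / 2)) p z)\<^sup>2 \<le> G z} \<in> sets lebesgue2"
        by measurable
      have "AE y in lebesgue. (gap (slobodeckii_weight (\<beta> / 2)) p (x, y))\<^sup>2 \<le> G (x, y)"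
        if "x \<notin> \<Omega> \<longrightarrow> p x = 0" for x
        unfolding G_def fst_conv snd_conv using p0 by (rule eventually_mono) (rule coercive_weight[where p=p, OF that])
      then show "AE x in lebesgue. AE y in lebesgue. (gap (slobodeckii_weight (\<beta> / 2)) p (x, y))\<^sup>2 \<le> G (x, y)"
        using p0 by (rule eventually_mono[rotated])
    qed
    then have "sq_int lebesgue2 (gap (slobodeckii_weight (\<beta> / 2)) p) \<le> (\<integral>\<^sup>+z. ennreal (G z) \<partial>lebesgue2)"
      unfolding sq_int_def by (intro nn_integral_mono_AE) (auto elim!: eventually_mono intro: ennreal_leI)
    also have "\<dots> = (\<integral>\<^sup>+z. ennreal (exp lam) * ennreal ((gap weight p z)\<^sup>2)
        + (ennreal 2 * (ennreal ((p (fst z))\<^sup>2) * ennreal (tail \<beta> (fst z - snd z)))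
        + ennreal 2 * (ennreal ((p (snd z))\<^sup>2) * ennreal (tail \<beta> (fst z - snd z)))) \<partial>lebesgue2)"
      unfolding G_def
      by (intro nn_integral_cong) (simp add: tail0 add.assoc mult.assoc del: ennreal_numeral flip: ennreal_plus ennreal_mult)
    also have "\<dots> = ennreal (exp lam) * energy p
        + (ennreal 2 * (\<integral>\<^sup>+z. ennreal ((p (fst z))\<^sup>2) * ennreal (tail \<beta> (fst z - snd z)) \<partial>lebesgue2)
        + ennreal 2 * (\<integral>\<^sup>+z. ennreal ((p (snd z))\<^sup>2) * ennreal (tail \<beta> (fst z - snd z)) \<partial>lebesgue2))"
      by (simp add: nn_integral_add nn_integral_cmult sq_int_def del: ennreal_numeral)
    also have "(\<integral>\<^sup>+z. ennreal ((p (fst z))\<^sup>2) * ennreal (tail \<beta> (fst z - snd z)) \<partial>lebesgue2)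
        = sq_int lebesgue p * ennreal K"
    proof (subst lebesgue.nn_integral_fst[symmetric])
      have [measurable]: "(\<lambda>y. tail \<beta> (x - y)) \<in> borel_measurable lebesgue" for x
        by (rule measurable_completion) simp
      show "(\<integral>\<^sup>+x. \<integral>\<^sup>+y. ennreal ((p (fst (x, y)))\<^sup>2) * ennreal (tail \<beta> (fst (x, y) - snd (x, y))) \<partial>lebesgue \<partial>lebesgue)
        = sq_int lebesgue p * ennreal K"
        by (simp add: nn_integral_cmult nn_integral_tail_shift K nn_integral_multc sq_int_def)
    qed measurable
    also have "(\<integral>\<^sup>+z. ennreal ((p (snd z))\<^sup>2) * ennreal (tail \<beta> (fst z - snd z)) \<partial>lebesgue2)
        = sq_int lebesgue p * ennreal K"
    proof (subst lebesgue_pair.nn_integral_snd[symmetric])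
      have [measurable]: "(\<lambda>x. tail \<beta> (x - y)) \<in> borel_measurable lebesgue" for y
        by (rule measurable_completion) simp
      have sym: "tail \<beta> (x - y) = tail \<beta> (y - x)" for x y
        by (simp add: tail_def abs_minus_commute)
      have "(\<integral>\<^sup>+x. ennreal (tail \<beta> (x - y)) \<partial>lebesgue) = ennreal K" for y
        unfolding sym[of _ y] by (simp add: nn_integral_tail_shift K)
      then show "(\<integral>\<^sup>+y. \<integral>\<^sup>+x. ennreal ((p (snd (x, y)))\<^sup>2) * ennreal (tail \<beta> (fst (x, y) - snd (x, y))) \<partial>lebesgue \<partial>lebesgue)
        = sq_int lebesgue p * ennreal K"
        by (simp add: nn_integral_cmult nn_integral_multc sq_int_def)
    qed measurable
    finally have "sq_int lebesgue2 (gap (slobodeckii_weight (\<beta> / 2)) p)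
        \<le> ennreal (exp lam) * energy p + (ennreal 2 * (sq_int lebesgue p * ennreal K) + ennreal 2 * (sq_int lebesgue p * ennreal K))" .
    moreover have L2: "sq_int lebesgue p \<le> ennreal C1 * energy p"
      unfolding C1_def by (rule Poincare[OF p p0])
    ultimately have "slobodeckii_sq (\<beta> / 2) UNIV p \<le> ennreal C1 * energy p + (ennreal (exp lam) * energy p
        + (ennreal 2 * (ennreal C1 * energy p * ennreal K) + ennreal 2 * (ennreal C1 * energy p * ennreal K)))"
      unfolding slobodeckii_sq_lebesgue[OF p]
      by (meson add_mono order_refl mult_left_mono mult_right_mono order_trans zero_le)
    also have "\<dots> = (ennreal C1 + (ennreal (exp lam) + (ennreal 2 * (ennreal K * ennreal C1) + ennreal 2 * (ennreal K * ennreal C1)))) * energy p"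
      by (simp only: distrib_right distrib_left mult_ac)
    also have "ennreal C1 + (ennreal (exp lam) + (ennreal 2 * (ennreal K * ennreal C1) + ennreal 2 * (ennreal K * ennreal C1)))
        = ennreal (C1 + exp lam + 4 * K * C1)"
      using nonneg by (simp del: ennreal_numeral flip: ennreal_plus ennreal_mult)
    finally show ?thesis .
  qed
  moreover have "0 \<le> C1 + exp lam + 4 * K * C1" using nonneg by simp
  ultimately show ?thesis by blast
qed

end

section \<open>Weak solutions\<close>

lemma slobodeckii_diff_finite:
  assumes "u \<in> borel_measurable lebesgue" "v \<in> borel_measurable lebesgue"
    and "slobodeckii_sq s UNIV u < \<infinity>" "slobodeckii_sq s UNIV v < \<infinity>"
  shows "slobodeckii_sq s UNIV (\<lambda>x. u x - v x) < \<infinity>"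
proof -
  have meas: "gap (slobodeckii_weight s) w \<in> borel_measurable lebesgue2" if "w \<in> borel_measurable lebesgue" for w
    using that by (intro measurable_gap measurable_lebesgue2) auto
  have fin: "sq_int lebesgue w < \<infinity>" "sq_int lebesgue2 (gap (slobodeckii_weight s) w) < \<infinity>"
    if "w \<in> borel_measurable lebesgue" "slobodeckii_sq s UNIV w < \<infinity>" for w
    using that by (auto simp: slobodeckii_sq_lebesgue)
  have "sq_int lebesgue (\<lambda>x. 1 * u x + (- 1) * v x) < \<infinity>"
    by (intro sq_int_lin_finite fin assms)
  moreover have "sq_int lebesgue2 (\<lambda>z. 1 * gap (slobodeckii_weight s) u z + (- 1) * gap (slobodeckii_weight s) v z) < \<infinity>"
    by (intro sq_int_lin_finite fin meas assms)
  ultimately show ?thesis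
    using assms(1,2) by (simp add: slobodeckii_sq_lebesgue gap_diff[abs_def])
qed

text \<open>
  A test function vanishes outside \<open>\<Omega>\<close>, so the $L^2$ norm of \<open>u\<close> over the complement is at most the
  distance from \<open>u\<close> to any test function.
\<close>

lemma H0_tilde_vanishes_outside:
  assumes u: "u \<in> H0_tilde s \<Omega>" and [measurable]: "\<Omega> \<in> sets borel"
  shows "AE x in lebesgue. x \<notin> \<Omega> \<longrightarrow> u x = 0"
proof -
  have [measurable]: "u \<in> borel_measurable lebesgue" and fin: "slobodeckii_sq s UNIV u < \<infinity>"
    using u by (auto simp: H0_tilde_def H_closure_def H_space_def lebesgue_on_UNIV_eq)
  have small: "(\<integral>\<^sup>+x. ennreal ((u x)\<^sup>2) * indicator (- \<Omega>) x \<partial>lebesgue) \<le> ennreal (r\<^sup>2)" if r: "0 < r" for r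
  proof -
    obtain \<phi> where \<phi>: "\<phi> \<in> test_functions \<Omega>" "\<phi> \<in> H_space s UNIV" and near: "H_norm s UNIV (\<lambda>x. u x - \<phi> x) < r"
      using u r by (auto simp: H0_tilde_def H_closure_def)
    have [measurable]: "\<phi> \<in> borel_measurable lebesgue" and fin\<phi>: "slobodeckii_sq s UNIV \<phi> < \<infinity>"
      using \<phi>(2) by (auto simp: H_space_def lebesgue_on_UNIV_eq)
    have "closure {x. \<phi> x \<noteq> 0} \<subseteq> \<Omega>"
      using \<phi>(1) by (simp add: test_functions_def)
    then have "{x. \<phi> x \<noteq> 0} \<subseteq> \<Omega>"
      by (rule order_trans[OF closure_subset])
    then have \<phi>0: "\<phi> x = 0" if "x \<notin> \<Omega>" for x
      using that by auto
    have pointwise: "ennreal ((u x)\<^sup>2) * indicator (- \<Omega>) x \<le> ennreal ((u x - \<phi> x)\<^sup>2)" for x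
      by (cases "x \<in> \<Omega>") (simp_all add: \<phi>0)
    have "(\<integral>\<^sup>+x. ennreal ((u x)\<^sup>2) * indicator (- \<Omega>) x \<partial>lebesgue) \<le> sq_int lebesgue (\<lambda>x. u x - \<phi> x)"
      unfolding sq_int_def by (intro nn_integral_mono pointwise)
    also have "\<dots> \<le> slobodeckii_sq s UNIV (\<lambda>x. u x - \<phi> x)"
      by (simp add: slobodeckii_sq_lebesgue)
    also have "\<dots> \<le> ennreal (r\<^sup>2)"
    proof -
      have "slobodeckii_sq s UNIV (\<lambda>x. u x - \<phi> x) < \<infinity>"
        by (intro slobodeckii_diff_finite fin fin\<phi>) auto
      moreover have "enn2real (slobodeckii_sq s UNIV (\<lambda>x. u x - \<phi> x)) \<le> r\<^sup>2"
        using near r unfolding H_norm_def by (intro sqrt_le_D less_imp_le)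
      ultimately show ?thesis
        by (metis ennreal_enn2real ennreal_leI infinity_ennreal_def)
    qed
    finally show ?thesis .
  qed
  have [measurable]: "- \<Omega> \<in> sets lebesgue"
    using assms(2) by (simp add: Compl_in_sets_lebesgue)
  have "(\<integral>\<^sup>+x. ennreal ((u x)\<^sup>2) * indicator (- \<Omega>) x \<partial>lebesgue) \<le> 0"
  proof (rule ennreal_le_epsilon)
    fix e :: real assume "0 < e"
    then show "(\<integral>\<^sup>+x. ennreal ((u x)\<^sup>2) * indicator (- \<Omega>) x \<partial>lebesgue) \<le> 0 + ennreal e"
      using small[of "sqrt e"] by simp
  qed
  then have "AE x in lebesgue. ennreal ((u x)\<^sup>2) * indicator (- \<Omega>) x = 0"
    unfolding le_zero_eq by (subst (asm) nn_integral_0_iff_AE) simp_all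
  then show ?thesis
    by eventually_elim (auto simp: indicator_def split: if_splits)
qed

text \<open>
  Restricting the integrals to \<open>\<Omega>\<close> decreases the norm, so an approximating sequence on the
  line also approximates on \<open>\<Omega>\<close>. Hence the dual pairing is defined on all of the solution space.
\<close>

lemma H0_tilde_subset_H0_space:
  assumes "u \<in> H0_tilde s \<Omega>" and [measurable]: "\<Omega> \<in> sets borel"
  shows "u \<in> H0_space s \<Omega>" and "H_norm s \<Omega> u \<le> H_norm s UNIV u"
proof -
  have \<Omega>: "\<Omega> \<inter> space lebesgue \<in> sets lebesgue" by simp
  have le: "slobodeckii_sq s \<Omega> w \<le> slobodeckii_sq s UNIV w" for w
  proof -
    have res: "(\<integral>\<^sup>+x. f x \<partial>lebesgue_on \<Omega>) \<le> (\<integral>\<^sup>+x. f x \<partial>lebesgue)" for f :: "real \<Rightarrow> ennreal"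
      unfolding nn_integral_restrict_space[OF \<Omega>]
      by (intro nn_integral_mono) (auto simp: indicator_def)
    show ?thesis
      unfolding slobodeckii_sq_def lebesgue_on_UNIV_eq
      by (intro add_mono res order_trans[OF nn_integral_mono[OF res] res])
  qed
  have norm: "H_norm s \<Omega> w \<le> H_norm s UNIV w" if "slobodeckii_sq s UNIV w < \<infinity>" for w
    unfolding H_norm_def using le that by (intro real_sqrt_le_mono enn2real_mono) auto
  have sub: "H_space s UNIV \<subseteq> H_space s \<Omega>"
    using le by (auto simp: H_space_def lebesgue_on_UNIV_eq measurable_restrict_space1 intro: le_less_trans)
  have uH: "u \<in> H_space s UNIV" using assms(1) by (simp add: H0_tilde_def H_closure_def)
  show "H_norm s \<Omega> u \<le> H_norm s UNIV u"
    using uH by (intro norm) (simp add: H_space_def)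
  show "u \<in> H0_space s \<Omega>"
    unfolding H0_space_def H_closure_def
  proof (intro CollectI conjI allI impI)
    show "u \<in> H_space s \<Omega>" using uH sub by blast
    fix \<epsilon> :: real assume "0 < \<epsilon>"
    then obtain \<phi> where \<phi>: "\<phi> \<in> test_functions \<Omega>" "\<phi> \<in> H_space s UNIV" "H_norm s UNIV (\<lambda>x. u x - \<phi> x) < \<epsilon>"
      using assms(1) by (auto simp: H0_tilde_def H_closure_def)
    have "slobodeckii_sq s UNIV (\<lambda>x. u x - \<phi> x) < \<infinity>"
      using uH \<phi>(2) by (intro slobodeckii_diff_finite) (auto simp: H_space_def lebesgue_on_UNIV_eq)
    then have "H_norm s \<Omega> (\<lambda>x. u x - \<phi> x) < \<epsilon>"
      by (rule le_less_trans[OF norm \<phi>(3)])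
    then show "\<exists>\<phi>\<in>test_functions \<Omega> \<inter> H_space s \<Omega>. H_norm s \<Omega> (\<lambda>x. u x - \<phi> x) < \<epsilon>"
      using \<phi> sub by blast
  qed
qed

context tempered_problem begin

lemma energy_space_eq_H0_tilde: "H0_tilde (\<beta> / 2) \<Omega> = energy_space"
proof
  show "H0_tilde (\<beta> / 2) \<Omega> \<subseteq> energy_space"
  proof
    fix u assume u: "u \<in> H0_tilde (\<beta> / 2) \<Omega>"
    then have "u \<in> finite_energy"
      by (intro slobodeckii_finite_energy) (auto simp: H0_tilde_def H_closure_def H_space_def lebesgue_on_UNIV_eq)
    then show "u \<in> energy_space"
      using H0_tilde_vanishes_outside[OF u] by (simp add: energy_space_def)
  qed
  show "energy_space \<subseteq> H0_tilde (\<beta> / 2) \<Omega>"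
  proof
    fix u assume u: "u \<in> energy_space"
    then have meas: "u \<in> borel_measurable lebesgue" and fin: "energy u < \<infinity>" and u0: "AE x in lebesgue. x \<notin> \<Omega> \<longrightarrow> u x = 0"
      by (auto simp: energy_space_def finite_energy_def)
    obtain C where "slobodeckii_sq (\<beta> / 2) UNIV u \<le> ennreal C * energy u"
      using coercive meas u0 by blast
    also have "\<dots> < \<infinity>" using fin by (simp add: ennreal_mult_less_top)
    finally show "u \<in> H0_tilde (\<beta> / 2) \<Omega>"
      unfolding \<Omega>_eq using \<beta> meas u0 by (intro H0_tilde_unit_interval) (auto simp: \<Omega>_eq)
  qed
qed

lemma energy_space_finite_energy: "u \<in> energy_space \<Longrightarrow> u \<in> finite_energy"
  by (simp add: energy_space_def)

lemma energy_space_lin: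
  assumes "u \<in> energy_space" "v \<in> energy_space"
  shows "(\<lambda>x. a * u x + b * v x) \<in> energy_space"
proof -
  have "AE x in lebesgue. x \<notin> \<Omega> \<longrightarrow> u x = 0" "AE x in lebesgue. x \<notin> \<Omega> \<longrightarrow> v x = 0"
    using assms by (auto simp: energy_space_def)
  then have "AE x in lebesgue. x \<notin> \<Omega> \<longrightarrow> a * u x + b * v x = 0"
    by eventually_elim simp
  then show ?thesis
    using assms by (simp add: energy_space_def finite_energy_lin)
qed

lemma energy_space_zero: "(\<lambda>_. 0) \<in> energy_space"
  by (simp add: energy_space_def finite_energy_def gap_def sq_int_def split_beta)

text \<open>
  Poincare's inequality makes the sequence converge almost everywhere, and Fatou's lemma applied to
  $v_m - v_n$ as \<open>m\<close> grows bounds the energy of the limit minus $v_n$.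
\<close>

lemma energy_space_complete:
  assumes v: "\<And>n. v n \<in> energy_space"
    and Cauchy: "\<And>n m. n \<le> m \<Longrightarrow> form (\<lambda>x. v m x - v n x) (\<lambda>x. v m x - v n x) \<le> (1/16)^n"
  shows "\<exists>u\<in>energy_space. (\<lambda>n. form (\<lambda>x. v n x - u x) (\<lambda>x. v n x - u x)) \<longlonglongrightarrow> 0"
proof -
  have meas[measurable]: "v n \<in> borel_measurable lebesgue" for n
    using v[of n] by (simp add: energy_space_def finite_energy_def)
  have diffW: "(\<lambda>x. v m x - v n x) \<in> energy_space" for m n
    using energy_space_lin[OF v v, of 1 m "-1" n] by simp
  have energy: "energy (\<lambda>x. v m x - v n x) \<le> ennreal ((1/16)^n)" if "n \<le> m" for m n
    using Cauchy[OF that] energy_space_finite_energy[OF diffW] by (simp add: energy_eq_form ennreal_leI)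
  define K where "K = exp (lam * 2) * 2 powr (1 + \<beta>)"
  have "AE x in lebesgue. convergent (\<lambda>n. v n x)"
  proof (rule sq_int_fast_Cauchy_AE_convergent[OF meas])
    fix n
    have "sq_int lebesgue (\<lambda>x. v (Suc n) x - v n x) \<le> ennreal K * energy (\<lambda>x. v (Suc n) x - v n x)"
      unfolding K_def using diffW[of "Suc n" n] by (intro Poincare) (auto simp: energy_space_def finite_energy_def)
    also have "\<dots> \<le> ennreal K * ennreal ((1/16)^n)"
      by (intro mult_left_mono energy) auto
    finally show "sq_int lebesgue (\<lambda>x. v (Suc n) x - v n x) \<le> ennreal (K * (1/16)^n)"
      by (simp add: K_def ennreal_mult)
  qed
  then have lim: "AE x in lebesgue. (\<lambda>n. v n x) \<longlonglongrightarrow> lim (\<lambda>n. v n x)"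
    by eventually_elim (simp add: convergent_LIMSEQ_iff)
  define u where "u x = lim (\<lambda>n. v n x)" for x
  have [measurable]: "u \<in> borel_measurable lebesgue"
    unfolding u_def by measurable
  have lim2: "AE z in lebesgue2. (\<lambda>n. gap weight (v n) z) \<longlonglongrightarrow> gap weight u z"
  proof (rule lebesgue_pair.AE_pair_measure)
    show "{z \<in> space lebesgue2. (\<lambda>n. gap weight (v n) z) \<longlonglongrightarrow> gap weight u z} \<in> sets lebesgue2"
      by measurable
    have "AE y in lebesgue. (\<lambda>n. gap weight (v n) (x, y)) \<longlonglongrightarrow> gap weight u (x, y)"
      if "(\<lambda>n. v n x) \<longlonglongrightarrow> lim (\<lambda>n. v n x)" for x
      using lim
    proof (rule eventually_mono)
      fix y assume "(\<lambda>n. v n y) \<longlonglongrightarrow> lim (\<lambda>n. v n y)"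
      then show "(\<lambda>n. gap weight (v n) (x, y)) \<longlonglongrightarrow> gap weight u (x, y)"
        unfolding gap_def prod.case u_def by (intro tendsto_mult tendsto_diff tendsto_const that)
    qed
    then show "AE x in lebesgue. AE y in lebesgue. (\<lambda>n. gap weight (v n) (x, y)) \<longlonglongrightarrow> gap weight u (x, y)"
      using lim by (rule eventually_mono[rotated])
  qed
  have near: "energy (\<lambda>x. u x - v n x) \<le> ennreal ((1/16)^n)" for n
  proof (rule sq_int_lim_le)
    show "AE z in lebesgue2. (\<lambda>m. gap weight (\<lambda>x. v m x - v n x) z) \<longlonglongrightarrow> gap weight (\<lambda>x. u x - v n x) z"
      using lim2 by eventually_elim (auto simp: gap_diff intro!: tendsto_intros)
    show "\<forall>\<^sub>F m in sequentially. energy (\<lambda>x. v m x - v n x) \<le> ennreal ((1/16)^n)"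
      using eventually_ge_at_top[of n] by eventually_elim (rule energy)
  qed simp
  have near': "(\<lambda>x. u x - v n x) \<in> finite_energy" for n
    using near[of n] by (auto simp: finite_energy_def intro: le_less_trans)
  have "u \<in> finite_energy"
    using finite_energy_lin[OF near'[of 0] energy_space_finite_energy[OF v[of 0]], of 1 1] by simp
  moreover have "AE x in lebesgue. x \<notin> \<Omega> \<longrightarrow> u x = 0"
  proof -
    have "AE x in lebesgue. \<forall>n. x \<notin> \<Omega> \<longrightarrow> v n x = 0"
      unfolding AE_all_countable using v by (simp add: energy_space_def)
    then show ?thesis
      by eventually_elim (simp add: u_def)
  qed
  ultimately have "u \<in> energy_space" by (simp add: energy_space_def)
  moreover have "(\<lambda>n. form (\<lambda>x. v n x - u x) (\<lambda>x. v n x - u x)) \<longlonglongrightarrow> 0"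
  proof (rule tendsto_sandwich[OF _ _ tendsto_const])
    show "\<forall>\<^sub>F n in sequentially. 0 \<le> form (\<lambda>x. v n x - u x) (\<lambda>x. v n x - u x)"
      by (simp add: form_nonneg)
    have swap: "form (\<lambda>x. v n x - u x) (\<lambda>x. v n x - u x) = form (\<lambda>x. u x - v n x) (\<lambda>x. u x - v n x)" for n
      unfolding form_def gap_diff by (simp add: algebra_simps)
    show "\<forall>\<^sub>F n in sequentially. form (\<lambda>x. v n x - u x) (\<lambda>x. v n x - u x) \<le> (1/16)^n"
      unfolding swap using near near'
      by (intro always_eventually allI) (simp add: energy_eq_form)
    show "(\<lambda>n. (1/16)^n :: real) \<longlonglongrightarrow> 0"
      by (rule LIMSEQ_power_zero) simp
  qed
  ultimately show ?thesis by blast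
qed

lemma weak_solution_unique:
  assumes p: "weak_solution \<beta> lam \<Omega> f g p" and q: "weak_solution \<beta> lam \<Omega> f g q"
  shows "AE x in lebesgue. q x = p x"
proof -
  obtain u \<eta> where pu: "AE x in lebesgue. p x = u x + \<eta> x" and \<eta>: "admissible_extension \<beta> \<Omega> g \<eta>"
    and u: "u \<in> energy_space" and eq: "\<And>v. v \<in> energy_space \<Longrightarrow> tempered_form \<beta> lam u v = f v - tempered_form \<beta> lam \<eta> v"
    using p unfolding weak_solution_def energy_space_eq_H0_tilde by blast
  obtain u' \<eta>' where qu: "AE x in lebesgue. q x = u' x + \<eta>' x" and \<eta>': "admissible_extension \<beta> \<Omega> g \<eta>'"
    and u': "u' \<in> energy_space" and eq': "\<And>v. v \<in> energy_space \<Longrightarrow> tempered_form \<beta> lam u' v = f v - tempered_form \<beta> lam \<eta>' v"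
    using q unfolding weak_solution_def energy_space_eq_H0_tilde by blast
  define P where "P x = 1 * u x + 1 * \<eta> x" for x
  define Q where "Q x = 1 * u' x + 1 * \<eta>' x" for x
  define w where "w x = 1 * P x + (- 1) * Q x" for x
  note fe = admissible_finite_energy[OF \<eta>] admissible_finite_energy[OF \<eta>'] energy_space_finite_energy[OF u] energy_space_finite_energy[OF u']
  have PE: "P \<in> finite_energy" and QE: "Q \<in> finite_energy"
    unfolding P_def Q_def by (intro finite_energy_lin fe)+
  then have wE: "w \<in> finite_energy"
    unfolding w_def by (intro finite_energy_lin)
  \<comment> \<open>The two extensions need not agree inside \<open>\<Omega>\<close>, so \<open>u - u'\<close> alone is not the difference of the solutions.\<close>
  have "AE x in lebesgue. x \<notin> \<Omega> \<longrightarrow> u x = 0" "AE x in lebesgue. x \<notin> \<Omega> \<longrightarrow> u' x = 0"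
    "AE x in lebesgue. x \<notin> \<Omega> \<longrightarrow> \<eta> x = g x" "AE x in lebesgue. x \<notin> \<Omega> \<longrightarrow> \<eta>' x = g x"
    using u u' \<eta> \<eta>' by (auto simp: energy_space_def admissible_extension_def)
  then have w0: "AE x in lebesgue. x \<notin> \<Omega> \<longrightarrow> w x = 0"
    by eventually_elim (simp add: w_def P_def Q_def)
  then have wW: "w \<in> energy_space" using wE by (simp add: energy_space_def)
  have c: "tempered_const \<beta> lam \<noteq> 0"
    using tempered_const_pos[OF \<beta>, of lam] by simp
  have "form P w = 1 * form u w + 1 * form \<eta> w"
    unfolding P_def by (rule form_lin[OF fe(3,1) wE])
  moreover have "form Q w = 1 * form u' w + 1 * form \<eta>' w"
    unfolding Q_def by (rule form_lin[OF fe(4,2) wE])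
  moreover have "tempered_const \<beta> lam / 2 * (form u w + form \<eta> w) = f w"
    using eq[OF wW] unfolding tempered_form_eq[OF fe(3) wW] tempered_form_eq[OF fe(1) wW] distrib_left by linarith
  moreover have "tempered_const \<beta> lam / 2 * (form u' w + form \<eta>' w) = f w"
    using eq'[OF wW] unfolding tempered_form_eq[OF fe(4) wW] tempered_form_eq[OF fe(2) wW] distrib_left by linarith
  ultimately have "form P w = form Q w"
    using c by (metis divide_eq_0_iff mult_1 mult_cancel_left zero_neq_numeral)
  moreover have "form w w = 1 * form P w + (- 1) * form Q w"
  proof -
    have "w = (\<lambda>x. 1 * P x + (- 1) * Q x)"
      by (rule ext) (rule w_def)
    then show ?thesis
      using form_lin[OF PE QE wE, of 1 "- 1"] by simp
  qed
  ultimately have "energy w = 0"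
    using energy_eq_form[OF wE] by simp
  then have "sq_int lebesgue w = 0"
    using Poincare[OF _ w0] wE by (simp add: finite_energy_def)
  then have "AE x in lebesgue. w x = 0"
    using wE unfolding sq_int_def finite_energy_def by (subst (asm) nn_integral_0_iff_AE) auto
  then show ?thesis
    using pu qu by eventually_elim (simp add: w_def P_def Q_def)
qed

text \<open>
  The functional \<open>L\<close> absorbs the constant \<open>c\<close> of the tempered form, so that the equation reads
  \<open>form u v = L v\<close>.
\<close>

lemma weak_solution_exists:
  assumes f: "f \<in> H_dual (\<beta> / 2) \<Omega>" and \<eta>: "admissible_extension \<beta> \<Omega> g \<eta>"
  shows "\<exists>p. weak_solution \<beta> lam \<Omega> f g p"
proof -
  define c where "c = tempered_const \<beta> lam / 2"
  have c: "0 < c" using tempered_const_pos[OF \<beta>] by (simp add: c_def)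
  have \<eta>E: "\<eta> \<in> finite_energy" by (rule admissible_finite_energy[OF \<eta>])
  have to_H0: "v \<in> H0_space (\<beta> / 2) \<Omega>" "H_norm (\<beta> / 2) \<Omega> v \<le> H_norm (\<beta> / 2) UNIV v" if "v \<in> energy_space" for v
    using that H0_tilde_subset_H0_space[of v "\<beta> / 2" \<Omega>] unfolding energy_space_eq_H0_tilde by auto
  have f_lin: "f (\<lambda>x. a * v x + b * w x) = a * f v + b * f w" if "v \<in> energy_space" "w \<in> energy_space" for v w a b
    using f to_H0(1) that by (simp add: H_dual_def)
  obtain C where f_bound: "\<And>v. v \<in> energy_space \<Longrightarrow> \<bar>f v\<bar> \<le> C * H_norm (\<beta> / 2) \<Omega> v"
    using f to_H0(1) unfolding H_dual_def by blast
  obtain D where D: "0 \<le> D" and coerc: "\<And>v. v \<in> energy_space \<Longrightarrow> slobodeckii_sq (\<beta> / 2) UNIV v \<le> ennreal D * energy v"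
    using coercive by (auto simp: energy_space_def finite_energy_def)
  define L where "L v = f v / c - form \<eta> v" for v
  have "\<exists>u\<in>energy_space. \<forall>v\<in>energy_space. form u v = L v"
  proof (rule Riesz_minimisation[where C="\<bar>C\<bar> * sqrt D / c + sqrt (form \<eta> \<eta>)"])
    fix u v a b assume uv: "u \<in> energy_space" "v \<in> energy_space"
    have "form \<eta> (\<lambda>x. a * u x + b * v x) = a * form \<eta> u + b * form \<eta> v"
      unfolding form_sym[of \<eta>] using uv by (intro form_lin energy_space_finite_energy \<eta>E)
    then show "L (\<lambda>x. a * u x + b * v x) = a * L u + b * L v"
      by (simp add: L_def f_lin[OF uv] add_divide_distrib algebra_simps)
  next
    fix v assume v: "v \<in> energy_space"
    have vE: "v \<in> finite_energy" by (rule energy_space_finite_energy[OF v])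
    have "slobodeckii_sq (\<beta> / 2) UNIV v \<le> ennreal (D * form v v)"
      using coerc[OF v] D by (simp add: energy_eq_form[OF vE] ennreal_mult form_nonneg)
    then have "enn2real (slobodeckii_sq (\<beta> / 2) UNIV v) \<le> D * form v v"
      using D by (intro enn2real_leI) (auto simp: form_nonneg)
    then have H: "H_norm (\<beta> / 2) UNIV v \<le> sqrt D * sqrt (form v v)"
      unfolding H_norm_def real_sqrt_mult[symmetric] by (rule real_sqrt_le_mono)
    have "\<bar>f v\<bar> \<le> \<bar>C\<bar> * H_norm (\<beta> / 2) \<Omega> v"
      using f_bound[OF v] by (rule order_trans) (intro mult_right_mono, auto simp: H_norm_def)
    also have "\<dots> \<le> \<bar>C\<bar> * (sqrt D * sqrt (form v v))"
      using to_H0(2)[OF v] H by (intro mult_left_mono) auto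
    finally have "\<bar>f v\<bar> / c \<le> \<bar>C\<bar> * (sqrt D * sqrt (form v v)) / c"
      using c by (intro divide_right_mono) auto
    moreover have "\<bar>L v\<bar> \<le> \<bar>f v\<bar> / c + \<bar>form \<eta> v\<bar>"
      using c abs_triangle_ineq4[of "f v / c" "form \<eta> v"] by (simp add: L_def abs_divide)
    ultimately show "\<bar>L v\<bar> \<le> (\<bar>C\<bar> * sqrt D / c + sqrt (form \<eta> \<eta>)) * sqrt (form v v)"
      using form_Cauchy_Schwarz[OF \<eta>E vE] by (simp add: algebra_simps)
  next
    fix u v w a b assume "u \<in> energy_space" "v \<in> energy_space" "w \<in> energy_space"
    then show "form (\<lambda>x. a * u x + b * v x) w = a * form u w + b * form v w"
      by (intro form_lin energy_space_finite_energy)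
  next
    fix v :: "nat \<Rightarrow> real \<Rightarrow> real"
    assume "\<And>n. v n \<in> energy_space"
      and "\<And>n m. n \<le> m \<Longrightarrow> form (\<lambda>x. v m x - v n x) (\<lambda>x. v m x - v n x) \<le> (1/16)^n"
    then show "\<exists>u\<in>energy_space. (\<lambda>n. form (\<lambda>x. v n x - u x) (\<lambda>x. v n x - u x)) \<longlonglongrightarrow> 0"
      by (rule energy_space_complete)
  qed (rule energy_space_zero energy_space_lin form_sym form_nonneg; assumption)+
  then obtain u where u: "u \<in> energy_space" and sol: "\<And>v. v \<in> energy_space \<Longrightarrow> form u v = L v" by blast
  have "tempered_form \<beta> lam u v = f v - tempered_form \<beta> lam \<eta> v" if v: "v \<in> energy_space" for v
  proof -
    have "c * form u v = f v - c * form \<eta> v"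
      using sol[OF v] c by (simp add: L_def right_diff_distrib)
    then show ?thesis
      unfolding tempered_form_eq[OF energy_space_finite_energy[OF u] v] tempered_form_eq[OF \<eta>E v] c_def .
  qed
  moreover have "(\<lambda>x. u x + \<eta> x) \<in> borel_measurable lebesgue"
    using energy_space_finite_energy[OF u] \<eta>E by (auto simp: finite_energy_def)
  ultimately have "weak_solution \<beta> lam \<Omega> f g (\<lambda>x. u x + \<eta> x)"
    unfolding weak_solution_def energy_space_eq_H0_tilde using u \<eta> by (intro conjI exI[of _ u] exI[of _ \<eta>]) simp_all
  then show ?thesis by blast
qed

end

theorem theorem6p1:
  fixes \<beta> lam :: real and \<Omega> :: "real set"
    and f :: "(real \<Rightarrow> real) \<Rightarrow> real" and g :: "real \<Rightarrow> real"
  assumes "\<Omega> = {0<..<1}"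
    and "0 < \<beta>" and "\<beta> < 2" and "0 \<le> lam"
    and "g \<in> borel_measurable (lebesgue_on (- \<Omega>))"
    and "f \<in> H_dual (\<beta> / 2) \<Omega>"
    and "\<exists>\<eta>. admissible_extension \<beta> \<Omega> g \<eta>"
  shows "\<exists>p. weak_solution \<beta> lam \<Omega> f g p \<and>
           (\<forall>q. weak_solution \<beta> lam \<Omega> f g q \<longrightarrow> (AE x in lebesgue. q x = p x))"
proof -
  interpret tempered_problem \<beta> lam \<Omega>
    using assms(1-4) by unfold_locales
  show ?thesis
    using weak_solution_exists[OF assms(6)] weak_solution_unique assms(7) by blast
qed

end
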